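(* Let $G$ be a finite simple graph. If $c_{1}(G-X)+\frac{2}{3}c_{3}(G-X)\leq \frac{4}{3}|X|+\frac{1}{3}$ for all $X\subseteq V(G)$, then $G$ has a $\{P_{2},P_{5}\}$-factor.
   Context: For a graph $H$ and an integer $i\geq 1$, $c_{i}(H)$ denotes the number of connected components of $H$ having exactly $i$ vertices. $P_{n}$ denotes the path on $n$ vertices. For a set $\mathcal{H}$ of connected graphs, an $\mathcal{H}$-factor of a graph is a spanning subgraph each of whose components is isomorphic to a graph in $\mathcal{H}$. For $X\subseteq V(G)$, $G-X$ is the subgraph obtained by deleting $X$. *)

theory Defs
  imports Complex_Main "Graph_Theory.Graph_Theory"
begin

text \<open>
  Finite simple graphs are \<^locale>\<open>pair_graph\<close>s: an undirected edge is represented by the two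
  arcs joining its ends. In such a symmetric digraph the strongly connected components
  \<^const>\<open>pre_digraph.sccs\<close> are the connected components (as induced subgraphs).
\<close>

definition delete_verts :: "'a pair_pre_digraph \<Rightarrow> 'a set \<Rightarrow> ('a, 'a \<times> 'a) pre_digraph" where
  "delete_verts G X = with_proj G \<restriction> (pverts G - X)"

definition num_components :: "nat \<Rightarrow> ('a, 'b) pre_digraph \<Rightarrow> nat" where
  "num_components i H = card {C \<in> pre_digraph.sccs H. card (verts C) = i}"

definition path_graph :: "nat \<Rightarrow> nat pair_pre_digraph" where
  "path_graph n =
    \<lparr> pverts = {..<n}, parcs = {(i, j). i < n \<and> j < n \<and> (j = Suc i \<or> i = Suc j)} \<rparr>"

text \<open>
  The requirement \<^term>\<open>pair_graph F\<close> makes the subgraph undirected: \<^const>\<open>spanning\<close> alone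
  would allow one to keep only one of the two arcs of an edge.
\<close>

definition is_factor ::
    "'b pair_pre_digraph set \<Rightarrow> 'a pair_pre_digraph \<Rightarrow> 'a pair_pre_digraph \<Rightarrow> bool" where
  "is_factor \<H> F G \<longleftrightarrow>
    pair_graph F \<and> spanning (with_proj F) (with_proj G) \<and>
    (\<forall>C \<in> pre_digraph.sccs (with_proj F). \<exists>P \<in> \<H>. digraph_iso C (with_proj P))"

definition has_factor :: "'b pair_pre_digraph set \<Rightarrow> 'a pair_pre_digraph \<Rightarrow> bool" where
  "has_factor \<H> G \<longleftrightarrow> (\<exists>F. is_factor \<H> F G)"

end

theory Submission
  imports Defs
begin

text \<open>
  By a Gallai--Edmonds argument there are a vertex set \<open>T\<close> such that all components of \<open>G - T\<close> are
  factor-critical, and a matching of \<open>T\<close> into distinct components. A factor-critical component with at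
  least five vertices has a \<open>{P\<^sub>2, P\<^sub>5}\<close>-factor of its own, so only singletons and triangles need help
  from \<open>T\<close>. In the bipartite graph between \<open>T\<close> and the components, an edge covers one component, a
  vertex of \<open>T\<close> adjacent to a component and to a triangle covers both of them, and a path with two
  vertices of \<open>T\<close> whose middle component is a singleton covers three. Giving singletons weight 3 and
  triangles weight 2, the hypothesis says that the components all of whose neighbours lie in
  \<open>Y \<subseteq> T\<close> have total weight at most \<open>4|Y| + 1\<close>. In a minimal counterexample to the tiling of all small
  components, sets of weight \<open>\<ge> 4|Y|\<close> split the problem and superfluous edges can be deleted, which
  leaves so little freedom that \<open>|T| \<le> 2\<close>. Finally, the matching is used to cover the rest of \<open>T\<close>.
\<close>

section \<open>Tilings of bipartite graphs\<close>

text \<open>\<open>N s\<close> is the neighbourhood of \<open>s\<close>; the weight \<open>w\<close> is 3 on singletons and 2 on triangles.\<close>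

inductive tiled :: "('s \<Rightarrow> 'a set) \<Rightarrow> ('s \<Rightarrow> nat) \<Rightarrow> 'a set \<Rightarrow> 's set \<Rightarrow> bool" for N w where
  empty: "tiled N w {} {}"
| edge: "\<lbrakk>tiled N w A S; a \<notin> A; s \<notin> S; a \<in> N s\<rbrakk> \<Longrightarrow> tiled N w (insert a A) (insert s S)"
| cherry: "\<lbrakk>tiled N w A S; a \<notin> A; s \<notin> S; t \<notin> S; s \<noteq> t; a \<in> N s; a \<in> N t; w t = 2\<rbrakk>
    \<Longrightarrow> tiled N w (insert a A) (insert s (insert t S))"
| zigzag: "\<lbrakk>tiled N w A S; a \<notin> A; b \<notin> A; a \<noteq> b; s \<notin> S; t \<notin> S; r \<notin> S; s \<noteq> t; t \<noteq> r; s \<noteq> r;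
      a \<in> N s; a \<in> N t; b \<in> N t; b \<in> N r; w t = 3\<rbrakk>
    \<Longrightarrow> tiled N w (insert a (insert b A)) (insert s (insert t (insert r S)))"

section \<open>Operations on tilings\<close>

lemma tiled_mono:
  assumes "tiled N w A S" "\<And>s. N s \<subseteq> N' s"
  shows "tiled N' w A S"
  using assms(1)
proof induction
  case empty show ?case by (rule tiled.empty)
next
  case edge then show ?case using assms(2) by (blast intro: tiled.edge)
next
  case cherry then show ?case using assms(2) by (intro tiled.cherry) auto
next
  case zigzag then show ?case using assms(2) by (intro tiled.zigzag) auto
qed

lemma tiled_Un:
  assumes "tiled N w A S" "tiled N w B T" "A \<inter> B = {}" "S \<inter> T = {}"
  shows "tiled N w (A \<union> B) (S \<union> T)"
  using assms(1,3,4)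
proof induction
  case empty then show ?case using assms(2) by simp
next
  case edge then show ?case by (auto intro!: tiled.edge)
next
  case cherry then show ?case by (auto intro!: tiled.cherry)
next
  case zigzag then show ?case by (auto intro!: tiled.zigzag)
qed

text \<open>A cherry without one of its components is an edge tile, and a zigzag without any one of
  its three components splits into two edge tiles, one for each of its two vertices. Only when the
  component of an edge tile is removed does a vertex of \<open>A\<close> become free, so
  \<open>A'\<close> may be smaller than \<open>A\<close>.\<close>

lemma tiled_remove:
  assumes "tiled N w A S" "s \<in> S"
  shows "\<exists>A'\<subseteq>A. tiled N w A' (S - {s})"
  using assms
proof (induction)
  case empty then show ?case by simp
next
  case (edge A S a u)
  show ?case
  proof (cases "s = u")
    case True
    then have "insert u S - {s} = S" using edge by auto
    then show ?thesis using edge by auto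
  next
    case False
    then obtain A' where "A' \<subseteq> A" "tiled N w A' (S - {s})" using edge by auto
    moreover have "insert u S - {s} = insert u (S - {s})" using False by auto
    moreover have "tiled N w (insert a A') (insert u (S - {s}))"
      using calculation edge by (intro tiled.edge) auto
    ultimately show ?thesis by (intro exI[of _ "insert a A'"]) auto
  qed
next
  case (cherry A S a u t)
  consider "s = u" | "s = t" | "s \<in> S" "s \<noteq> u" "s \<noteq> t" using cherry by auto
  then show ?case
  proof cases
    case 1
    have "tiled N w (insert a A) (insert t S)" using cherry by (intro tiled.edge)
    moreover have "insert u (insert t S) - {s} = insert t S" using 1 cherry by auto
    ultimately show ?thesis by auto
  next
    case 2
    have "tiled N w (insert a A) (insert u S)" using cherry by (intro tiled.edge)
    moreover have "insert u (insert t S) - {s} = insert u S" using 2 cherry by auto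
    ultimately show ?thesis by auto
  next
    case 3
    then obtain A' where "A' \<subseteq> A" "tiled N w A' (S - {s})" using cherry by auto
    moreover have "insert u (insert t S) - {s} = insert u (insert t (S - {s}))" using 3 by auto
    moreover have "tiled N w (insert a A') (insert u (insert t (S - {s})))"
      using calculation cherry by (intro tiled.cherry) auto
    ultimately show ?thesis by (intro exI[of _ "insert a A'"]) auto
  qed
next
  case (zigzag A S a b u t r)
  consider "s = u" | "s = t" | "s = r" | "s \<in> S" "s \<noteq> u" "s \<noteq> t" "s \<noteq> r" using zigzag by auto
  then show ?case
  proof cases
    case 1
    have "tiled N w (insert a (insert b A)) (insert t (insert r S))"
      using zigzag by (auto intro!: tiled.edge)
    moreover have "insert u (insert t (insert r S)) - {s} = insert t (insert r S)"
      using 1 zigzag by auto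
    ultimately show ?thesis by auto
  next
    case 2
    have "tiled N w (insert a (insert b A)) (insert u (insert r S))"
      using zigzag by (auto intro!: tiled.edge)
    moreover have "insert u (insert t (insert r S)) - {s} = insert u (insert r S)"
      using 2 zigzag by auto
    ultimately show ?thesis by auto
  next
    case 3
    have "tiled N w (insert b (insert a A)) (insert t (insert u S))"
      using zigzag by (auto intro!: tiled.edge)
    moreover have "insert u (insert t (insert r S)) - {s} = insert t (insert u S)"
      using 3 zigzag by auto
    ultimately show ?thesis by (intro exI[of _ "insert b (insert a A)"]) auto
  next
    case 4
    then obtain A' where "A' \<subseteq> A" "tiled N w A' (S - {s})" using zigzag by auto
    moreover have "insert u (insert t (insert r S)) - {s} = insert u (insert t (insert r (S - {s})))"
      using 4 by auto
    moreover have "tiled N w (insert a (insert b A')) (insert u (insert t (insert r (S - {s}))))"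
      using calculation zigzag by (intro tiled.zigzag) auto
    ultimately show ?thesis by (intro exI[of _ "insert a (insert b A')"]) auto
  qed
qed

text \<open>As in the Mendelsohn--Dulmage theorem, a matching can be absorbed one edge at a time:
  every tile stays a union of tiles when one of its \<open>s\<close>-vertices is removed.\<close>

lemma tiled_absorb_matching:
  assumes "finite B" "tiled N w A S" "inj_on M B" "\<And>b. b \<in> B \<Longrightarrow> b \<in> N (M b)"
  shows "\<exists>A' S'. tiled N w A' S' \<and> B \<subseteq> A' \<and> A' \<subseteq> A \<union> B \<and> S \<subseteq> S' \<and> S' \<subseteq> S \<union> M ` B"
  using assms
proof (induction "card B" arbitrary: A S B)
  case 0
  then show ?case by auto
next
  case (Suc n)
  show ?case
  proof (cases "B \<subseteq> A")
    case True
    then show ?thesis using Suc.prems by blast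
  next
    case False
    then obtain a where a: "a \<in> B" "a \<notin> A" by blast
    \<comment> \<open>Taking \<open>M a\<close> out of its tile first keeps it available for
      \<open>a\<close>; by injectivity of \<open>M\<close> the induction hypothesis for
      \<open>B - {a}\<close> cannot bring it back.\<close>
    obtain A0 where A0: "A0 \<subseteq> A" "tiled N w A0 (S - {M a})"
      using tiled_remove[OF Suc.prems(2), of "M a"] Suc.prems(2) by (cases "M a \<in> S") auto
    have "n = card (B - {a})" using Suc.hyps(2) a Suc.prems(1) by simp
    then have "\<exists>A' S'. tiled N w A' S' \<and> B - {a} \<subseteq> A' \<and> A' \<subseteq> A0 \<union> (B - {a}) \<and>
        S - {M a} \<subseteq> S' \<and> S' \<subseteq> (S - {M a}) \<union> M ` (B - {a})"
      using Suc.prems A0 by (intro Suc.hyps(1)) (auto intro: inj_on_diff)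
    then obtain A' S' where *: "tiled N w A' S'" "B - {a} \<subseteq> A'" "A' \<subseteq> A0 \<union> (B - {a})"
        "S - {M a} \<subseteq> S'" "S' \<subseteq> (S - {M a}) \<union> M ` (B - {a})" by blast
    have "a \<notin> A'" using * A0 a by auto
    moreover have "M a \<notin> S'" using * Suc.prems(3) a(1) by (auto simp: inj_on_def)
    ultimately have "tiled N w (insert a A') (insert (M a) S')"
      using * a Suc.prems by (intro tiled.edge) auto
    moreover have "B \<subseteq> insert a A'" "insert a A' \<subseteq> A \<union> B" "S \<subseteq> insert (M a) S'"
       "insert (M a) S' \<subseteq> S \<union> M ` B" using * a A0 by auto
    ultimately show ?thesis by blast
  qed
qed

section \<open>Hall's marriage theorem\<close>

text \<open>The Halmos-Vaughan induction: a nonempty proper subset with exactly as many neighbours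
  as elements splits the problem in two; if there is none, an arbitrary first choice can be
  made.\<close>

theorem hall_marriage:
  assumes "finite A" "\<And>a. a \<in> A \<Longrightarrow> finite (N a)"
    and "\<And>Y. Y \<subseteq> A \<Longrightarrow> card Y \<le> card (\<Union>(N ` Y))"
  shows "\<exists>M. inj_on M A \<and> (\<forall>a\<in>A. M a \<in> N a)"
  using assms
proof (induction "card A" arbitrary: A N rule: less_induct)
  case less
  note fin = less.prems(1,2) and hall = less.prems(3)
  show ?case
  proof (cases "\<exists>Y. Y \<subset> A \<and> Y \<noteq> {} \<and> card (\<Union>(N ` Y)) = card Y")
    case True
    then obtain Y where Y: "Y \<subset> A" "Y \<noteq> {}" "card (\<Union>(N ` Y)) = card Y" by blast
    have finY: "finite Y" using Y fin finite_subset by blast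
    have "card Y < card A" using Y fin psubset_card_mono by blast
    have "\<exists>M. inj_on M Y \<and> (\<forall>a\<in>Y. M a \<in> N a)"
    proof (rule less.hyps[OF \<open>card Y < card A\<close> finY])
      show "finite (N a)" if "a \<in> Y" for a using fin(2) that Y(1) by auto
      show "card Z \<le> card (\<Union>(N ` Z))" if "Z \<subseteq> Y" for Z using that Y(1) by (intro hall) auto
    qed
    then obtain M1 where M1: "inj_on M1 Y" "\<forall>a\<in>Y. M1 a \<in> N a" by blast
    \<comment> \<open>Deleting all neighbours of the tight set \<open>Y\<close> preserves Hall's
      condition on \<open>A - Y\<close>: apply the condition to \<open>Y \<union> Z\<close> and
      subtract the equality for \<open>Y\<close>.\<close>
    define N' where "N' a = N a - \<Union>(N ` Y)" for a
    have "card (A - Y) < card A" using Y fin by (intro psubset_card_mono) auto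
    moreover have "card Z \<le> card (\<Union>(N' ` Z))" if "Z \<subseteq> A - Y" for Z
    proof -
      have finZ: "finite Z" using that fin finite_subset by blast
      have "card (Y \<union> Z) \<le> card (\<Union>(N ` (Y \<union> Z)))" using that Y by (intro hall) auto
      moreover have "card (Y \<union> Z) = card Y + card Z"
        using that finY finZ by (intro card_Un_disjoint) auto
      moreover have "\<Union>(N ` (Y \<union> Z)) = \<Union>(N ` Y) \<union> \<Union>(N' ` Z)" unfolding N'_def by auto
      moreover have "card (\<Union>(N ` Y) \<union> \<Union>(N' ` Z)) \<le> card (\<Union>(N ` Y)) + card (\<Union>(N' ` Z))"
        by (rule card_Un_le)
      ultimately have "card Y + card Z \<le> card Y + card (\<Union>(N' ` Z))"
        using Y(3) by simp
      then show ?thesis by simp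
    qed
    ultimately obtain M2 where M2: "inj_on M2 (A - Y)" "\<forall>a\<in>A-Y. M2 a \<in> N' a"
      using less.hyps[of "A - Y" N'] fin by (auto simp: N'_def)
    define M where "M a = (if a \<in> Y then M1 a else M2 a)" for a
    have *: "M1 a \<noteq> M2 b" if "a \<in> Y" "b \<in> A - Y" for a b
      using M1(2) M2(2) that unfolding N'_def by (metis DiffD2 UN_I)
    have "inj_on M A"
      unfolding inj_on_def
    proof (intro ballI impI)
      fix a b assume ab: "a \<in> A" "b \<in> A" "M a = M b"
      then show "a = b" using M1(1) M2(1) *[of a b] *[of b a]
        by (cases "a \<in> Y"; cases "b \<in> Y") (auto simp: M_def inj_on_def)
    qed
    moreover have "\<forall>a\<in>A. M a \<in> N a" using M1 M2 Y by (auto simp: M_def N'_def)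
    ultimately show ?thesis by blast
  next
    case False
    show ?thesis
    proof (cases "A = {}")
      case True then show ?thesis by simp
    next
      case nonempty: False
      then obtain a where a: "a \<in> A" by blast
      have "card {a} \<le> card (\<Union>(N ` {a}))" using a by (intro hall) auto
      then have "N a \<noteq> {}" by auto
      then obtain x where x: "x \<in> N a" by blast
      define N' where "N' b = N b - {x}" for b
      have "card (A - {a}) < card A" using a fin by (metis card_Diff1_less)
      moreover have "card Z \<le> card (\<Union>(N' ` Z))" if Z: "Z \<subseteq> A - {a}" for Z
      proof (cases "Z = {}")
        case True then show ?thesis by simp
      next
        case ne: False
        have finN: "finite (\<Union>(N ` Z))" using Z fin finite_subset by blast
        \<comment> \<open>Every nonempty proper subset has a neighbour to spare, which pays for the
          loss of \<open>x\<close>.\<close>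
        have "Z \<subset> A" using Z a by auto
        then have "card Z < card (\<Union>(N ` Z))"
          using False ne hall[of Z] by (metis le_neq_implies_less psubset_imp_subset)
        moreover have "\<Union>(N' ` Z) = \<Union>(N ` Z) - {x}" by (auto simp: N'_def)
        moreover have "card (\<Union>(N ` Z)) - 1 \<le> card (\<Union>(N ` Z) - {x})"
          by (simp add: card_Diff_singleton_if)
        ultimately show ?thesis by simp
      qed
      ultimately obtain M where M: "inj_on M (A - {a})" "\<forall>b\<in>A-{a}. M b \<in> N' b"
        using less.hyps[of "A - {a}" N'] fin by (auto simp: N'_def)
      have "inj_on (M(a := x)) A" using M by (auto simp: inj_on_def N'_def)
      moreover have "\<forall>b\<in>A. (M(a := x)) b \<in> N b" using M x by (auto simp: N'_def)
      ultimately show ?thesis by blast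
    qed
  qed
qed

section \<open>Weight enclosed by a set of vertices\<close>

definition enclosed :: "('s \<Rightarrow> 'a set) \<Rightarrow> 's set \<Rightarrow> 'a set \<Rightarrow> 's set" where
  "enclosed N S Y = {s \<in> S. N s \<subseteq> Y}"

lemma finite_enclosed [simp]: "finite S \<Longrightarrow> finite (enclosed N S Y)"
  by (simp add: enclosed_def)

text \<open>The families enclosed by \<open>Y\<close> and by \<open>Z\<close> meet in the one
  enclosed by \<open>Y \<inter> Z\<close>, and their union misses only the components that cross.
  Keeping the crossing weight turns supermodularity into an equation, which makes the later
  uncrossing exact.\<close>

lemma sum_enclosed_Un:
  fixes w :: "'s \<Rightarrow> nat"
  assumes "finite S"
  shows "sum w (enclosed N S (Y \<union> Z)) + sum w (enclosed N S (Y \<inter> Z)) =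
    sum w (enclosed N S Y) + sum w (enclosed N S Z)
      + sum w {s \<in> S. N s \<subseteq> Y \<union> Z \<and> \<not> N s \<subseteq> Y \<and> \<not> N s \<subseteq> Z}" (is "_ = _ + sum w ?X")
proof -
  have "enclosed N S (Y \<union> Z) = (enclosed N S Y \<union> enclosed N S Z) \<union> ?X"
    by (auto simp: enclosed_def)
  moreover have "sum w ((enclosed N S Y \<union> enclosed N S Z) \<union> ?X)
      = sum w (enclosed N S Y \<union> enclosed N S Z) + sum w ?X"
    using assms by (intro sum.union_disjoint) (auto simp: enclosed_def)
  moreover have "enclosed N S Y \<inter> enclosed N S Z = enclosed N S (Y \<inter> Z)"
    by (auto simp: enclosed_def)
  ultimately show ?thesis
    using sum.union_inter[of "enclosed N S Y" "enclosed N S Z" w] assms by simp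
qed

section \<open>Instances in which no reduction is possible\<close>

text \<open>What is left when every reduction is blocked: \<open>not_tight\<close> and
  \<open>connected\<close> rule out splitting along \<open>Y\<close>. In
  \<open>edge_critical\<close>, the set \<open>Y\<close> violates \<open>bound\<close> once the edge
  between \<open>s\<close> and \<open>a\<close> is deleted, because \<open>s\<close> then becomes
  enclosed as well. A tiling is constructed directly from these conditions.\<close>

locale critical_tiling =
  fixes A :: "'a set" and S :: "'s set" and N :: "'s \<Rightarrow> 'a set" and w :: "'s \<Rightarrow> nat"
  assumes finite_A: "finite A" and finite_S: "finite S"
    and weights: "s \<in> S \<Longrightarrow> w s = 2 \<or> w s = 3"
    and N_subset: "s \<in> S \<Longrightarrow> N s \<subseteq> A"
    and bound: "Y \<subseteq> A \<Longrightarrow> sum w (enclosed N S Y) \<le> 4 * card Y + 1"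
    and not_tight: "Y \<subset> A \<Longrightarrow> Y \<noteq> {} \<Longrightarrow> sum w (enclosed N S Y) < 4 * card Y"
    and edge_critical: "s \<in> S \<Longrightarrow> a \<in> N s \<Longrightarrow>
      \<exists>Y\<subseteq>A. a \<notin> Y \<and> N s - {a} \<subseteq> Y \<and> 4 * card Y + 2 \<le> sum w (enclosed N S Y) + w s"
    and connected: "Y \<subset> A \<Longrightarrow> Y \<noteq> {} \<Longrightarrow> \<exists>s\<in>S. \<not> N s \<subseteq> Y \<and> \<not> N s \<subseteq> A - Y"
begin

abbreviation "W Y \<equiv> sum w (enclosed N S Y)"

lemma W_mem: "s \<in> enclosed N S Y \<Longrightarrow> w s \<le> W Y"
  using finite_S by (intro member_le_sum) auto

text \<open>A component without neighbours would put weight at least 2 on the empty set, whose bound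
  is 1.\<close>

lemma N_nonempty: assumes "s \<in> S" shows "N s \<noteq> {}"
proof
  assume "N s = {}"
  then have "s \<in> enclosed N S {}" using assms by (simp add: enclosed_def)
  then show False using W_mem[of s "{}"] weights[OF assms] bound[of "{}"] by auto
qed

lemma W_empty [simp]: "W {} = 0"
proof -
  have "enclosed N S {} = {}" using N_nonempty by (auto simp: enclosed_def)
  then show ?thesis by simp
qed

text \<open>A single component already weighs at least 2. The value 1 is the contradiction reached
  in \<open>bridge_side\<close>.\<close>

lemma W_neq_1: "W Y \<noteq> 1"
proof (cases "enclosed N S Y = {}")
  case False
  then obtain s where "s \<in> enclosed N S Y" by blast
  then show ?thesis using W_mem[of s Y] weights[of s] by (auto simp: enclosed_def)
qed simp

lemma W_disjoint_Un:
  assumes "Y \<inter> Z = {}" "\<And>s. s \<in> S \<Longrightarrow> N s \<subseteq> Y \<union> Z \<Longrightarrow> N s \<subseteq> Y \<or> N s \<subseteq> Z"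
  shows "W (Y \<union> Z) = W Y + W Z"
proof -
  have "sum w {s \<in> S. N s \<subseteq> Y \<union> Z \<and> \<not> N s \<subseteq> Y \<and> \<not> N s \<subseteq> Z} = 0"
    using assms(2) by (intro sum.neutral) blast
  moreover have "W (Y \<inter> Z) = 0" using assms(1) by simp
  ultimately show ?thesis using sum_enclosed_Un[OF finite_S, of w N Y Z] by linarith
qed

text \<open>Only \<open>s\<close> meets both \<open>Z\<close> and \<open>A - Z\<close>, and both
  sides have the largest weight that \<open>not_tight\<close> permits, one below four times their
  size. The vertex \<open>b\<close> is the end of \<open>s\<close> inside \<open>Z\<close>.\<close>

definition bridge :: "'s \<Rightarrow> 'a \<Rightarrow> 'a \<Rightarrow> 'a set \<Rightarrow> bool" where
  "bridge s a b Z \<longleftrightarrow> s \<in> S \<and> w s = 3 \<and> N s = {a, b} \<and> Z \<subseteq> A \<and> a \<in> A - Z \<and> b \<in> Z \<and>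
    W Z + 1 = 4 * card Z \<and> W (A - Z) + 1 = 4 * card (A - Z) \<and>
    (\<forall>s'\<in>S. s' \<noteq> s \<longrightarrow> N s' \<subseteq> Z \<or> N s' \<subseteq> A - Z)"

lemma bridge_commute: "bridge s a b Z \<Longrightarrow> bridge s b a (A - Z)"
  by (auto simp: bridge_def double_diff insert_commute)

text \<open>Criticality of the edges from \<open>s\<close> to \<open>a\<close> and \<open>b\<close>
  yields \<open>Y\<close> and \<open>Z\<close>. Since both miss tightness by at least one,
  \<open>w s = 3\<close> and both miss it by exactly one. Uncrossing them, with \<open>s\<close>
  among the crossing components, gives union and intersection together a weight of at least one
  above four times their sizes. So the union is \<open>A\<close>, the intersection is empty, and
  nothing but \<open>s\<close> crosses.\<close>

lemma bridge_exists:
  assumes s: "s \<in> S" and a: "a \<in> N s" and b: "b \<in> N s" and ab: "a \<noteq> b"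
  shows "(\<exists>Z. bridge s a b Z) \<and> W A = 4 * card A + 1"
proof -
  obtain Y where Y: "Y \<subseteq> A" "a \<notin> Y" "N s - {a} \<subseteq> Y" "4 * card Y + 2 \<le> W Y + w s"
    using edge_critical[OF s a] by blast
  obtain Z where Z: "Z \<subseteq> A" "b \<notin> Z" "N s - {b} \<subseteq> Z" "4 * card Z + 2 \<le> W Z + w s"
    using edge_critical[OF s b] by blast
  have mem: "b \<in> Y" "a \<in> Z" using a b ab Y Z by auto
  have "Y \<subset> A" "Z \<subset> A" using mem Y Z by auto
  then have lt: "W Y < 4 * card Y" "W Z < 4 * card Z" using not_tight mem by blast+
  then have w3: "w s = 3" using weights[OF s] Y by auto
  let ?X = "{s \<in> S. N s \<subseteq> Y \<union> Z \<and> \<not> N s \<subseteq> Y \<and> \<not> N s \<subseteq> Z}"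
  have sX: "s \<in> ?X" using s a b Y Z mem by auto
  then have X3: "3 \<le> sum w ?X" using w3 finite_S member_le_sum[of s ?X w] by auto
  have fin: "finite Y" "finite Z" using Y Z finite_A finite_subset by blast+
  note eq = sum_enclosed_Un[OF finite_S, of w N Y Z]
  have cards: "card (Y \<union> Z) + card (Y \<inter> Z) = card Y + card Z"
    using card_Un_Int[OF fin] by simp
  have "Y \<inter> Z \<subset> A" using mem Y Z by auto
  then have Int_le: "W (Y \<inter> Z) \<le> 4 * card (Y \<inter> Z)"
    using not_tight[of "Y \<inter> Z"] by (cases "Y \<inter> Z = {}") auto
  have Un_A: "Y \<union> Z = A"
  proof (rule ccontr)
    assume "Y \<union> Z \<noteq> A"
    then have "W (Y \<union> Z) < 4 * card (Y \<union> Z)" using Y Z mem by (intro not_tight) auto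
    then show False using eq cards Int_le X3 Y Z w3 by linarith
  qed
  have A_le: "W A \<le> 4 * card A + 1" by (rule bound) simp
  have disj: "Y \<inter> Z = {}"
  proof (rule ccontr)
    assume "Y \<inter> Z \<noteq> {}"
    then have "W (Y \<inter> Z) < 4 * card (Y \<inter> Z)" using \<open>Y \<inter> Z \<subset> A\<close> not_tight by blast
    then show False using eq cards A_le X3 Y Z w3 Un_A by simp
  qed
  have Zeq: "Z = A - Y" using Un_A disj by auto
  have AW: "W A = W Y + W Z + sum w ?X" using eq Un_A disj by simp
  have cardA: "card A = card Y + card Z" using cards Un_A disj by simp
  have X_le: "sum w ?X \<le> 3" using AW cardA A_le Y(4) Z(4) w3 by linarith
  have only: "N s' \<subseteq> Y \<or> N s' \<subseteq> Z" if "s' \<in> S" "s' \<noteq> s" for s'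
  proof (rule ccontr)
    assume "\<not> ?thesis"
    then have "s' \<in> ?X" using that N_subset Un_A by auto
    then have "sum w {s, s'} \<le> sum w ?X" using sX finite_S by (intro sum_mono2) auto
    then show False using X_le that w3 weights[of s'] by auto
  qed
  have "N s = {a, b}" using a b Y Z disj by blast
  then have "bridge s a b Y" unfolding bridge_def
    using s w3 Y Z mem only lt Zeq by auto
  moreover have "W A = 4 * card A + 1" using AW cardA lt X3 Y Z w3 X_le by linarith
  ultimately show ?thesis by blast
qed

text \<open>Were \<open>Z\<close> larger, a second bridge \<open>s'\<close> at \<open>b\<close>
  would cut off a set \<open>Z'\<close> inside \<open>Z\<close>. The vertices in
  \<open>A - Z\<close>, in \<open>Z'\<close> and \<open>b\<close> then form a tight set, so they
  exhaust \<open>A\<close>; comparing with \<open>W A = 4 * card A + 1\<close> leaves weight 1 for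
  \<open>{b}\<close>.\<close>

lemma bridge_side:
  assumes "bridge s a b Z"
  shows "Z = {b}"
proof (rule ccontr)
  assume Z_neq: "Z \<noteq> {b}"
  have s: "s \<in> S" "w s = 3" "N s = {a, b}" and Z: "Z \<subseteq> A" "a \<in> A" "a \<notin> Z" "b \<in> Z"
    and WZ: "W Z + 1 = 4 * card Z" "W (A - Z) + 1 = 4 * card (A - Z)"
    and only: "\<And>s'. s' \<in> S \<Longrightarrow> s' \<noteq> s \<Longrightarrow> N s' \<subseteq> Z \<or> N s' \<subseteq> A - Z"
    using assms by (auto simp: bridge_def)
  have WA: "W A = 4 * card A + 1" using bridge_exists[of s a b] s Z by auto
  have finZ: "finite Z" using Z finite_A finite_subset by blast
  \<comment> \<open>Otherwise the weight of \<open>Z\<close> is the sum of those of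
    \<open>{b}\<close> and \<open>Z - {b}\<close>. Each is at least one below four times its size,
    whereas \<open>Z\<close> is only one below in total.\<close>
  have "\<exists>s'\<in>S. N s' \<subseteq> Z \<and> \<not> N s' \<subseteq> {b} \<and> \<not> N s' \<subseteq> Z - {b}"
  proof (rule ccontr)
    assume none: "\<not> ?thesis"
    have "W ({b} \<union> (Z - {b})) = W {b} + W (Z - {b})"
      using none Z by (intro W_disjoint_Un) (auto simp: insert_absorb)
    moreover have "{b} \<union> (Z - {b}) = Z" using Z by auto
    moreover have "W {b} < 4 * card {b}" using Z by (intro not_tight) auto
    moreover have "W (Z - {b}) < 4 * card (Z - {b})" using Z Z_neq by (intro not_tight) auto
    moreover have "card Z = Suc (card (Z - {b}))" using Z finZ by (metis card_Suc_Diff1)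
    ultimately show False using WZ by simp
  qed
  then obtain s' c where s': "s' \<in> S" "N s' \<subseteq> Z" "b \<in> N s'" "c \<in> N s'" "c \<noteq> b" by blast
  then obtain Z' where "bridge s' b c Z'" using bridge_exists[of s' b c] by auto
  then have s'3: "w s' = 3" "N s' = {b, c}" and Z': "Z' \<subseteq> A" "b \<notin> Z'" "c \<in> Z'"
    and WZ': "W Z' + 1 = 4 * card Z'"
    and only': "\<And>s''. s'' \<in> S \<Longrightarrow> s'' \<noteq> s' \<Longrightarrow> N s'' \<subseteq> Z' \<or> N s'' \<subseteq> A - Z'"
    by (auto simp: bridge_def)
  have ss': "s \<noteq> s'" using s s' Z by auto
  have finZ': "finite Z'" using Z' finite_A finite_subset by blast
  \<comment> \<open>Only \<open>s\<close> could link the parts of \<open>Z'\<close> inside and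
    outside \<open>Z\<close>, but its neighbour \<open>b\<close> is not in \<open>Z'\<close>. So the
    weight of \<open>Z'\<close> splits, again with a deficit of at least two.\<close>
  have "Z' \<subseteq> Z"
  proof (rule ccontr)
    assume "\<not> Z' \<subseteq> Z"
    have "W ((Z' \<inter> Z) \<union> (Z' - Z)) = W (Z' \<inter> Z) + W (Z' - Z)"
    proof (intro W_disjoint_Un)
      fix s'' assume "s'' \<in> S" "N s'' \<subseteq> (Z' \<inter> Z) \<union> (Z' - Z)"
      moreover have "s'' \<noteq> s" using calculation s Z' by auto
      ultimately show "N s'' \<subseteq> Z' \<inter> Z \<or> N s'' \<subseteq> Z' - Z" using only[of s''] by auto
    qed auto
    moreover have "(Z' \<inter> Z) \<union> (Z' - Z) = Z'" by auto
    moreover have "W (Z' \<inter> Z) < 4 * card (Z' \<inter> Z)"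
      using Z Z' s' by (intro not_tight) auto
    moreover have "W (Z' - Z) < 4 * card (Z' - Z)"
      using Z Z' \<open>\<not> Z' \<subseteq> Z\<close> by (intro not_tight) auto
    moreover have "card Z' = card (Z' \<inter> Z) + card (Z' - Z)"
      using finZ' card_Int_Diff by blast
    ultimately show False using WZ' by simp
  qed
  let ?B = "A - Z"
  let ?D = "insert b (?B \<union> Z')"
  have disjoint: "enclosed N S ?B \<inter> enclosed N S Z' = {}"
    using N_nonempty \<open>Z' \<subseteq> Z\<close> by (fastforce simp: enclosed_def)
  have ss_sum: "sum w (enclosed N S ?B \<union> enclosed N S Z' \<union> {s, s'}) = W ?B + W Z' + 6"
  proof -
    have "sum w (enclosed N S ?B \<union> enclosed N S Z' \<union> {s, s'})
        = sum w (enclosed N S ?B \<union> enclosed N S Z') + sum w {s, s'}"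
      using finite_S s s'3 Z Z' by (intro sum.union_disjoint) (auto simp: enclosed_def)
    also have "sum w {s, s'} = 6" using s s'3 ss' by simp
    finally show ?thesis using disjoint finite_S by (simp add: sum.union_disjoint)
  qed
  have cardD: "card ?D = card ?B + card Z' + 1"
  proof -
    have "card ?D = Suc (card (?B \<union> Z'))" using Z Z' finZ' finite_A by (intro card_insert_disjoint) auto
    moreover have "card (?B \<union> Z') = card ?B + card Z'"
      using \<open>Z' \<subseteq> Z\<close> finZ' finite_A by (intro card_Un_disjoint) auto
    ultimately show ?thesis by simp
  qed
  \<comment> \<open>The deficits of 1 on \<open>?B\<close> and on \<open>Z'\<close>, the weight 6 of
    \<open>s\<close> and \<open>s'\<close>, and the cost 4 of the vertex \<open>b\<close> cancel:
    \<open>?D\<close> has weight at least four times its size.\<close>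
  have "?D = A"
  proof (rule ccontr)
    assume "?D \<noteq> A"
    then have "W ?D < 4 * card ?D" using Z Z' by (intro not_tight) auto
    moreover have "sum w (enclosed N S ?B \<union> enclosed N S Z' \<union> {s, s'}) \<le> W ?D"
      using finite_S s s' s'3 Z Z' by (intro sum_mono2) (auto simp: enclosed_def)
    ultimately show False using ss_sum WZ WZ' cardD by linarith
  qed
  have "enclosed N S A = (enclosed N S ?B \<union> enclosed N S Z' \<union> {s, s'}) \<union> enclosed N S {b}" (is "?L = ?R")
  proof
    show "?R \<subseteq> ?L" using s s' Z Z' N_subset by (auto simp: enclosed_def)
    show "?L \<subseteq> ?R"
    proof
      fix x assume "x \<in> ?L"
      then have x: "x \<in> S" by (simp add: enclosed_def)
      have "N x \<subseteq> ?B \<or> N x \<subseteq> Z' \<or> N x \<subseteq> {b}" if "x \<noteq> s" "x \<noteq> s'"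
        using only[OF x that(1)] only'[OF x that(2)] \<open>?D = A\<close> by blast
      then show "x \<in> ?R" using x by (auto simp: enclosed_def)
    qed
  qed
  moreover have "sum w ?R = sum w (enclosed N S ?B \<union> enclosed N S Z' \<union> {s, s'}) + W {b}"
  proof (intro sum.union_disjoint)
    have False if "x \<in> S" "N x \<subseteq> {b}" "N x \<subseteq> ?B \<or> N x \<subseteq> Z' \<or> x = s \<or> x = s'" for x
      using N_nonempty[OF that(1)] that(2,3) Z Z' s s'3 s' by auto
    then show "(enclosed N S ?B \<union> enclosed N S Z' \<union> {s, s'}) \<inter> enclosed N S {b} = {}"
      by (auto simp: enclosed_def)
  qed (use finite_S in auto)
  ultimately have "W A = W ?B + W Z' + 6 + W {b}" using ss_sum by simp
  then have "W {b} = 1" using WA \<open>?D = A\<close> cardD WZ WZ' by simp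
  then show False using W_neq_1 by blast
qed

lemma W_eq_3:
  assumes "W Y = 3"
  shows "\<exists>x. enclosed N S Y = {x} \<and> w x = 3"
proof -
  have "enclosed N S Y \<noteq> {}" using assms by auto
  then obtain x where x: "x \<in> enclosed N S Y" by blast
  have "enclosed N S Y - {x} = {}"
  proof (rule ccontr)
    assume "\<not> ?thesis"
    then obtain y where y: "y \<in> enclosed N S Y" "y \<noteq> x" by blast
    have "sum w {x, y} \<le> W Y" using x y finite_S by (intro sum_mono2) auto
    then show False using assms x y weights[of x] weights[of y] by (auto simp: enclosed_def)
  qed
  then have "enclosed N S Y = {x}" using x by auto
  then show ?thesis using assms by auto
qed

text \<open>A component with two neighbours is a bridge whose sides are single vertices. Each side
  has weight 3, hence encloses one component, and the whole instance is one zigzag. Otherwise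
  connectedness leaves at most one vertex in \<open>A\<close>; total weight at most 5 then allows at
  most two components, one of them of weight 2 if there are two.\<close>

lemma tiled: "\<exists>A'\<subseteq>A. tiled N w A' S"
proof (cases "\<exists>s\<in>S. \<exists>a\<in>N s. \<exists>b\<in>N s. a \<noteq> b")
  case True
  then obtain s a b Z where br: "bridge s a b Z" and ab: "a \<noteq> b" using bridge_exists by blast
  have Z: "Z = {b}" "A - Z = {a}"
    using bridge_side[OF br] bridge_side[OF bridge_commute[OF br]] by auto
  have s: "s \<in> S" "w s = 3" "N s = {a, b}" and W: "W {a} = 3" "W {b} = 3"
    and only: "\<And>s'. s' \<in> S \<Longrightarrow> s' \<noteq> s \<Longrightarrow> N s' \<subseteq> {a} \<or> N s' \<subseteq> {b}" and A: "A = {a, b}"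
    using br Z ab by (auto simp: bridge_def)
  obtain x where x: "enclosed N S {a} = {x}" using W_eq_3[OF W(1)] by blast
  obtain y where y: "enclosed N S {b} = {y}" using W_eq_3[OF W(2)] by blast
  have xy: "x \<in> S" "y \<in> S" "N x = {a}" "N y = {b}"
    using x y N_nonempty[of x] N_nonempty[of y] unfolding enclosed_def by blast+
  have S: "S = {x, s, y}"
  proof
    show "S \<subseteq> {x, s, y}"
    proof
      fix z assume z: "z \<in> S"
      show "z \<in> {x, s, y}"
        using only[OF z] x y z unfolding enclosed_def by blast
    qed
  qed (use s xy in auto)
  have "tiled N w (insert a (insert b {})) (insert x (insert s (insert y {})))"
    using ab s xy by (intro tiled.zigzag tiled.empty) auto
  then show ?thesis using A S by auto
next
  case False
  show ?thesis
  proof (cases "\<exists>a. A \<subseteq> {a}")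
    case no: False
    then obtain a where a: "a \<in> A" by blast
    then have "{a} \<subset> A" using no by auto
    then obtain s where s: "s \<in> S" "\<not> N s \<subseteq> {a}" "\<not> N s \<subseteq> A - {a}" using connected[of "{a}"] by auto
    then obtain b where "a \<in> N s" "b \<in> N s" "b \<noteq> a" using N_subset[OF s(1)] by auto
    then show ?thesis using False s by blast
  next
    case True
    then obtain a where a: "A \<subseteq> {a}" by blast
    have N: "N s = {a}" if "s \<in> S" for s using N_nonempty[OF that] N_subset[OF that] a by blast
    show ?thesis
    proof (cases "S = {}")
      case True then show ?thesis using tiled.empty by blast
    next
      case ne: False
      then obtain x where x: "x \<in> S" by blast
      then have A: "A = {a}" using N[OF x] N_subset[OF x] a by auto
      have enc: "enclosed N S A = S" using N_subset by (auto simp: enclosed_def)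
      then have le: "sum w S \<le> 5" using bound[of A] A by simp
      show ?thesis
      proof (cases "S = {x}")
        case True
        have "tiled N w (insert a {}) (insert x {})" using N x by (intro tiled.edge tiled.empty) auto
        then show ?thesis using A True by auto
      next
        case False
        then obtain y where y: "y \<in> S" "y \<noteq> x" using x by blast
        have S: "S = {x, y}"
        proof (rule ccontr)
          assume "S \<noteq> {x, y}"
          then obtain z where z: "z \<in> S" "z \<noteq> x" "z \<noteq> y" using x y by blast
          have "sum w {x, y, z} \<le> sum w S" using x y z finite_S by (intro sum_mono2) auto
          then show False using le x y z weights[of x] weights[of y] weights[of z] by auto
        qed
        have "tiled N w {a} {x, y}"
        proof (cases "w y = 2")
          case True
          have "tiled N w (insert a {}) (insert x (insert y {}))"
            using N x y True by (intro tiled.cherry tiled.empty) auto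
          then show ?thesis by simp
        next
          case False
          then have "w x = 2" using le S y weights[OF x] weights[OF y(1)] by auto
          then have "tiled N w (insert a {}) (insert y (insert x {}))"
            using N x y by (intro tiled.cherry tiled.empty) auto
          then show ?thesis by (simp add: insert_commute)
        qed
        then show ?thesis using A S by auto
      qed
    qed
  qed
qed

end

section \<open>Reduction to critical instances\<close>

text \<open>Induction on the number of vertices in \<open>A\<close> plus the number of edges. A
  tight or disconnecting set splits the instance, a redundant edge is deleted, and the failure of
  all three is the critical case.\<close>

lemma tiling_exists:
  fixes N :: "'s \<Rightarrow> 'a set" and w :: "'s \<Rightarrow> nat"
  assumes "finite A" "finite S" "\<And>s. s \<in> S \<Longrightarrow> w s = 2 \<or> w s = 3" "\<And>s. s \<in> S \<Longrightarrow> N s \<subseteq> A"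
    and "\<And>Y. Y \<subseteq> A \<Longrightarrow> sum w (enclosed N S Y) \<le> 4 * card Y + 1"
  shows "\<exists>A'\<subseteq>A. tiled N w A' S"
  using assms
proof (induction "card A + (\<Sum>s\<in>S. card (N s))" arbitrary: A S N rule: less_induct)
  case less
  note fin = less.prems(1,2) and wt = less.prems(3) and sub = less.prems(4) and bound = less.prems(5)
  consider (tight) Y where "Y \<subset> A" "Y \<noteq> {}" "4 * card Y \<le> sum w (enclosed N S Y)"
    | (disconnected) Y where "Y \<subset> A" "Y \<noteq> {}" "\<forall>s\<in>S. N s \<subseteq> Y \<or> N s \<subseteq> A - Y"
    | (redundant) s a where "s \<in> S" "a \<in> N s" "\<And>Y. Y \<subseteq> A \<Longrightarrow> a \<notin> Y \<Longrightarrow> N s - {a} \<subseteq> Y \<Longrightarrow>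
        sum w (enclosed N S Y) + w s < 4 * card Y + 2"
    | (critical) "critical_tiling A S N w"
  proof (cases "critical_tiling A S N w")
    case False
    have "critical_tiling A S N w" if no: "\<not> thesis"
    proof
      fix Y assume Y: "Y \<subset> A" "Y \<noteq> {}"
      show "sum w (enclosed N S Y) < 4 * card Y" using tight[OF Y] no by linarith
      show "\<exists>s\<in>S. \<not> N s \<subseteq> Y \<and> \<not> N s \<subseteq> A - Y" using disconnected[OF Y] no by blast
    next
      fix s a assume "s \<in> S" "a \<in> N s"
      show "\<exists>Y\<subseteq>A. a \<notin> Y \<and> N s - {a} \<subseteq> Y \<and> 4 * card Y + 2 \<le> sum w (enclosed N S Y) + w s"
      proof (rule ccontr)
        assume "\<not> ?thesis"
        then have thesis
          by (intro redundant[OF \<open>s \<in> S\<close> \<open>a \<in> N s\<close>]) (meson not_le)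
        then show False using no by contradiction
      qed
    qed (use less.prems in auto)
    then show ?thesis using False by blast
  qed
  then show ?case
  proof cases
    case tight
    let ?S = "enclosed N S Y"
    have finY: "finite Y" using tight fin finite_subset by blast
    have cY: "card Y < card A" using tight fin psubset_card_mono by blast
    have cAY: "card (A - Y) < card A" using tight fin by (intro psubset_card_mono) auto
    have "(\<Sum>s\<in>?S. card (N s)) \<le> (\<Sum>s\<in>S. card (N s))"
      using fin by (intro sum_mono2) (auto simp: enclosed_def)
    moreover have "sum w (enclosed N ?S Z) \<le> 4 * card Z + 1" if "Z \<subseteq> Y" for Z
    proof -
      have "enclosed N ?S Z = enclosed N S Z" using that by (auto simp: enclosed_def)
      then show ?thesis using bound[of Z] that tight by auto
    qed
    ultimately have "\<exists>A'\<subseteq>Y. tiled N w A' ?S"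
      using finY fin cY wt by (intro less.hyps) (auto simp: enclosed_def)
    then obtain A1 where A1: "A1 \<subseteq> Y" "tiled N w A1 ?S" by blast
    let ?N = "\<lambda>s. N s - Y"
    have finN: "finite (N s)" if "s \<in> S" for s using fin sub[OF that] finite_subset by blast
    then have "(\<Sum>s\<in>S - ?S. card (?N s)) \<le> (\<Sum>s\<in>S - ?S. card (N s))"
      by (intro sum_mono card_mono) auto
    also have "\<dots> \<le> (\<Sum>s\<in>S. card (N s))" using fin by (intro sum_mono2) auto
    finally have "(\<Sum>s\<in>S - ?S. card (?N s)) \<le> (\<Sum>s\<in>S. card (N s))" .
    \<comment> \<open>The set \<open>Y\<close> accounts for at least \<open>4 * card Y\<close> of
      the weight enclosed by \<open>Y \<union> Z\<close>, so the rest obeys the bound for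
      \<open>Z\<close> with the same slack of 1.\<close>
    moreover have "sum w (enclosed ?N (S - ?S) Z) \<le> 4 * card Z + 1" if Z: "Z \<subseteq> A - Y" for Z
    proof -
      have "enclosed ?N (S - ?S) Z = enclosed N S (Y \<union> Z) - ?S" by (auto simp: enclosed_def)
      then have "sum w (enclosed ?N (S - ?S) Z) = sum w (enclosed N S (Y \<union> Z)) - sum w ?S"
        using fin by (simp add: sum_diff_nat enclosed_def Collect_mono le_supI1)
      moreover have "sum w (enclosed N S (Y \<union> Z)) \<le> 4 * card (Y \<union> Z) + 1"
        using Z tight by (intro bound) auto
      moreover have "card (Y \<union> Z) \<le> card Y + card Z" by (rule card_Un_le)
      ultimately show ?thesis using tight by linarith
    qed
    ultimately have "\<exists>A'\<subseteq>A-Y. tiled ?N w A' (S - ?S)"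
      using fin cAY wt sub by (intro less.hyps) auto
    then obtain A2 where A2: "A2 \<subseteq> A - Y" "tiled ?N w A2 (S - ?S)" by blast
    have "tiled N w A2 (S - ?S)" using A2 by (rule_tac tiled_mono) auto
    then have "tiled N w (A1 \<union> A2) (?S \<union> (S - ?S))" using A1 A2 by (intro tiled_Un) auto
    moreover have "?S \<union> (S - ?S) = S" by (auto simp: enclosed_def)
    ultimately show ?thesis using A1 A2 tight by (intro exI[of _ "A1 \<union> A2"]) auto
  next
    case disconnected
    let ?S = "enclosed N S Y"
    have finY: "finite Y" using disconnected fin finite_subset by blast
    have cY: "card Y < card A" using disconnected fin psubset_card_mono by blast
    have cAY: "card (A - Y) < card A" using disconnected fin by (intro psubset_card_mono) auto
    have *: "(\<Sum>s\<in>T. card (N s)) \<le> (\<Sum>s\<in>S. card (N s))" if "T \<subseteq> S" for T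
      using fin that by (intro sum_mono2) auto
    have **: "sum w (enclosed N T Z) \<le> 4 * card Z + 1" if "Z \<subseteq> A" "T \<subseteq> S" for Z T
    proof -
      have "sum w (enclosed N T Z) \<le> sum w (enclosed N S Z)"
        using that fin by (intro sum_mono2) (auto simp: enclosed_def)
      then show ?thesis using bound[OF that(1)] by linarith
    qed
    have "?S \<subseteq> S" by (auto simp: enclosed_def)
    then have "\<exists>A'\<subseteq>Y. tiled N w A' ?S"
      using fin finY cY wt *[of ?S] **[of _ ?S] disconnected
      by (intro less.hyps) (auto simp: enclosed_def)
    then obtain A1 where A1: "A1 \<subseteq> Y" "tiled N w A1 ?S" by blast
    have "\<exists>A'\<subseteq>A-Y. tiled N w A' (S - ?S)"
    proof (intro less.hyps)
      show "N s \<subseteq> A - Y" if "s \<in> S - ?S" for s using disconnected that by (auto simp: enclosed_def)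
      show "card (A - Y) + (\<Sum>s\<in>S - ?S. card (N s)) < card A + (\<Sum>s\<in>S. card (N s))"
        using cAY *[of "S - ?S"] by auto
    qed (use fin wt **[of _ "S - ?S"] in auto)
    then obtain A2 where A2: "A2 \<subseteq> A - Y" "tiled N w A2 (S - ?S)" by blast
    have "tiled N w (A1 \<union> A2) (?S \<union> (S - ?S))" using A1 A2 by (intro tiled_Un) auto
    moreover have "?S \<union> (S - ?S) = S" by (auto simp: enclosed_def)
    ultimately show ?thesis using A1 A2 disconnected by (intro exI[of _ "A1 \<union> A2"]) auto
  next
    case redundant
    let ?N = "N(s := N s - {a})"
    have finN: "finite (N t)" if "t \<in> S" for t using fin sub[OF that] finite_subset by blast
    have "(\<Sum>t\<in>S. card (?N t)) < (\<Sum>t\<in>S. card (N t))"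
    proof (rule sum_strict_mono_ex1)
      show "\<forall>t\<in>S. card (?N t) \<le> card (N t)" using finN by (auto intro: card_mono)
      show "\<exists>t\<in>S. card (?N t) < card (N t)"
        using redundant(1,2) card_Diff1_less[OF finN[OF redundant(1)] redundant(2)]
        by (intro bexI[of _ s]) (simp_all del: card_Diff_insert)
    qed (use fin in auto)
    moreover have "sum w (enclosed ?N S Y) \<le> 4 * card Y + 1" if Y: "Y \<subseteq> A" for Y
    proof (cases "a \<notin> Y \<and> N s - {a} \<subseteq> Y")
      case True
      \<comment> \<open>Deleting the edge can newly enclose only \<open>s\<close>; the redundancy
        condition allows for precisely this extra weight.\<close>
      have "enclosed ?N S Y \<subseteq> insert s (enclosed N S Y)" by (auto simp: enclosed_def split: if_splits)
      then have "sum w (enclosed ?N S Y) \<le> sum w (insert s (enclosed N S Y))"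
        using fin by (intro sum_mono2) auto
      also have "\<dots> \<le> w s + sum w (enclosed N S Y)" using fin
        by (simp add: sum.insert_if)
      finally show ?thesis using redundant(3)[OF Y] True by simp
    next
      case False
      then have "enclosed ?N S Y = enclosed N S Y" by (auto simp: enclosed_def split: if_splits)
      then show ?thesis using bound[OF Y] by simp
    qed
    ultimately have "\<exists>A'\<subseteq>A. tiled ?N w A' S"
      using fin wt sub by (intro less.hyps) auto
    then obtain A' where "A' \<subseteq> A" "tiled ?N w A' S" by blast
    moreover from this have "tiled N w A' S" by (rule_tac tiled_mono) (auto split: if_splits)
    ultimately show ?thesis by blast
  next
    case critical
    then show ?thesis by (rule critical_tiling.tiled)
  qed
qed

section \<open>Factor-critical decompositions\<close>

inductive perfectly_matched :: "('a \<Rightarrow> 'a \<Rightarrow> bool) \<Rightarrow> 'a set \<Rightarrow> bool" for E where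
  empty: "perfectly_matched E {}"
| insert: "\<lbrakk>perfectly_matched E U; u \<notin> U; v \<notin> U; u \<noteq> v; E u v\<rbrakk>
    \<Longrightarrow> perfectly_matched E (insert u (insert v U))"

text \<open>Paths are lists of vertices, so \<open>L\<close> prescribes numbers of vertices, as in
  the indices of the paths.\<close>

inductive path_partitioned :: "nat set \<Rightarrow> ('a \<Rightarrow> 'a \<Rightarrow> bool) \<Rightarrow> 'a set \<Rightarrow> bool" for L E where
  empty: "path_partitioned L E {}"
| path: "\<lbrakk>path_partitioned L E U; distinct p; set p \<inter> U = {}; successively E p; length p \<in> L\<rbrakk>
    \<Longrightarrow> path_partitioned L E (set p \<union> U)"

definition factor_critical :: "('a \<Rightarrow> 'a \<Rightarrow> bool) \<Rightarrow> 'a set \<Rightarrow> bool" where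
  "factor_critical E C \<longleftrightarrow> C \<noteq> {} \<and> (\<forall>x\<in>C. perfectly_matched E (C - {x}))"

text \<open>For symmetric \<open>E\<close> these are the unions of components of the subgraph
  induced on \<open>U\<close>. Allowing several components lets leftover vertices be gathered into
  one closed set.\<close>

definition closed_in :: "('a \<Rightarrow> 'a \<Rightarrow> bool) \<Rightarrow> 'a set \<Rightarrow> 'a set \<Rightarrow> bool" where
  "closed_in E U C \<longleftrightarrow> C \<subseteq> U \<and> (\<forall>x\<in>C. \<forall>y\<in>U - C. \<not> E x y)"

lemma perfectly_matched_finite: "perfectly_matched E U \<Longrightarrow> finite U"
  by (induction rule: perfectly_matched.induct) auto

lemma perfectly_matched_even: "perfectly_matched E U \<Longrightarrow> even (card U)"
  by (induction rule: perfectly_matched.induct) (auto dest: perfectly_matched_finite)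

lemma perfectly_matched_Un:
  assumes "perfectly_matched E U" "perfectly_matched E V" "U \<inter> V = {}"
  shows "perfectly_matched E (U \<union> V)"
  using assms(1,3)
  by induction (auto intro: assms(2) perfectly_matched.insert)

lemma path_partitioned_Un:
  assumes "path_partitioned L E U" "path_partitioned L E V" "U \<inter> V = {}"
  shows "path_partitioned L E (U \<union> V)"
  using assms(1,3)
proof induction
  case (path U p)
  then have "path_partitioned L E (set p \<union> (U \<union> V))" by (intro path_partitioned.path) auto
  then show ?case by (simp add: Un_assoc)
qed (simp add: assms(2))

lemma perfectly_matched_imp_path_partitioned:
  assumes "perfectly_matched E U" "2 \<in> L"
  shows "path_partitioned L E U"
  using assms(1)
proof induction
  case (insert U u v)
  then have "path_partitioned L E (set [u, v] \<union> U)"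
    using assms(2) by (intro path_partitioned.path) (auto simp: numeral_eq_Suc)
  then show ?case by simp
qed (rule path_partitioned.empty)

lemma path_partitioned_Union:
  assumes "finite P" "\<And>C. C \<in> P \<Longrightarrow> path_partitioned L E C"
    and "\<And>C D. C \<in> P \<Longrightarrow> D \<in> P \<Longrightarrow> C \<noteq> D \<Longrightarrow> C \<inter> D = {}"
  shows "path_partitioned L E (\<Union>P)"
  using assms
proof (induction P)
  case (insert C P)
  have "path_partitioned L E (C \<union> \<Union>P)"
  proof (rule path_partitioned_Un)
    show "C \<inter> \<Union>P = {}" using insert.prems(2)[of C] insert.hyps(2) by blast
  qed (use insert in auto)
  then show ?case by simp
qed (simp add: path_partitioned.empty)

lemma disjnt_Union_if_pairwise: "pairwise disjnt (insert s S) \<Longrightarrow> s \<notin> S \<Longrightarrow> disjnt s (\<Union>S)"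
  by (auto simp: pairwise_insert disjnt_def)

lemma even_card_Union_odd:
  assumes "finite P" "\<And>C. C \<in> P \<Longrightarrow> finite C \<and> odd (card C)"
    and "\<And>C D. C \<in> P \<Longrightarrow> D \<in> P \<Longrightarrow> C \<noteq> D \<Longrightarrow> C \<inter> D = {}"
  shows "even (card (\<Union>P)) \<longleftrightarrow> even (card P)"
  using assms
proof (induction P)
  case (insert C P)
  have "C \<inter> \<Union>P = {}" using insert.prems(2)[of C] insert.hyps(2) by blast
  then have "card (\<Union>(insert C P)) = card C + card (\<Union>P)"
    using insert by (simp add: card_Un_disjoint)
  then show ?case using insert by auto
qed simp

lemma factor_critical_finite: "factor_critical E C \<Longrightarrow> finite C"
  using perfectly_matched_finite by (fastforce simp: factor_critical_def)

lemma factor_critical_odd: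
  assumes "factor_critical E C"
  shows "odd (card C)"
proof -
  obtain x where x: "x \<in> C" "perfectly_matched E (C - {x})"
    using assms by (auto simp: factor_critical_def)
  have "card C = Suc (card (C - {x}))"
    using card.remove[OF factor_critical_finite[OF assms] x(1)] by simp
  then show ?thesis using perfectly_matched_even[OF x(2)] by simp
qed

locale symmetric_relation =
  fixes E :: "'a \<Rightarrow> 'a \<Rightarrow> bool"
  assumes E_sym: "E u v \<Longrightarrow> E v u"
begin

lemma perfectly_matched_partner:
  assumes "perfectly_matched E U" "x \<in> U"
  shows "\<exists>y\<in>U. x \<noteq> y \<and> E x y \<and> perfectly_matched E (U - {x, y})"
  using assms
proof induction
  case (insert U u v)
  consider "x = u" | "x = v" | "x \<in> U" "x \<noteq> u" "x \<noteq> v" using insert.prems by auto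
  then show ?case
  proof cases
    case 1
    have "insert u (insert v U) - {u, v} = U" using insert by auto
    then show ?thesis using 1 insert by (intro bexI[of _ v]) auto
  next
    case 2
    have "insert u (insert v U) - {v, u} = U" using insert by auto
    then show ?thesis using 2 insert E_sym by (intro bexI[of _ u]) auto
  next
    case 3
    then obtain y where y: "y \<in> U" "x \<noteq> y" "E x y" "perfectly_matched E (U - {x, y})"
      using insert by auto
    have "insert u (insert v U) - {x, y} = insert u (insert v (U - {x, y}))"
      using 3 y insert by auto
    moreover have "perfectly_matched E (insert u (insert v (U - {x, y})))"
      using y insert by (intro perfectly_matched.insert) auto
    ultimately show ?thesis using y by (intro bexI[of _ y]) auto
  qed
qed simp

text \<open>Pairing \<open>t\<close> with a neighbour \<open>x\<close> in \<open>M t\<close> leaves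
  \<open>M t - {x}\<close>, which has a perfect matching by factor-criticality.\<close>

lemma perfectly_matched_absorb_critical:
  assumes "finite T" "\<And>t. t \<in> T \<Longrightarrow> factor_critical E (M t) \<and> (\<exists>x\<in>M t. E t x)"
    and "\<And>s t. s \<in> T \<Longrightarrow> t \<in> T \<Longrightarrow> s \<noteq> t \<Longrightarrow> M s \<inter> M t = {}" "\<Union>(M ` T) \<inter> T = {}"
  shows "perfectly_matched E (T \<union> \<Union>(M ` T))"
  using assms
proof (induction T)
  case (insert t T)
  obtain x where x: "x \<in> M t" "E t x" using insert.prems by blast
  have "perfectly_matched E (M t - {x})" using insert.prems(1)[of t] x by (auto simp: factor_critical_def)
  then have *: "perfectly_matched E (insert t (insert x (M t - {x})))"
    using x insert.prems by (intro perfectly_matched.insert) auto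
  have IH: "perfectly_matched E (T \<union> \<Union>(M ` T))"
    using insert.prems by (intro insert.IH) auto
  have "M t \<inter> \<Union>(M ` T) = {}" using insert.prems(2)[of t] insert.hyps(2) by blast
  then have "perfectly_matched E (insert t (insert x (M t - {x})) \<union> (T \<union> \<Union>(M ` T)))"
    using x insert.prems(3) insert.hyps(2) by (intro perfectly_matched_Un[OF * IH]) auto
  moreover have "insert t (insert x (M t - {x})) \<union> (T \<union> \<Union>(M ` T)) = insert t T \<union> \<Union>(M ` insert t T)"
    using x by auto
  ultimately show ?case by metis
qed (simp add: perfectly_matched.empty)

text \<open>A near-perfect matching missing \<open>v\<close> contains two edges that extend \<open>v\<close> to a path with five
  vertices, unless \<open>v\<close> lies in a triangle without edges to the outside.\<close>

lemma factor_critical_path_partitioned: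
  assumes U: "factor_critical E U" and card: "4 \<le> card U" and L: "2 \<in> L" "5 \<in> L"
  shows "path_partitioned L E U"
proof -
  have finU: "finite U" using U by (rule factor_critical_finite)
  have pm: "perfectly_matched E (U - {u})" if "u \<in> U" for u
    using U that by (simp add: factor_critical_def)
  have P5: "path_partitioned L E U"
    if "distinct [a, b, c, d, e]" "{a, b, c, d, e} \<subseteq> U" "E a b" "E b c" "E c d" "E d e"
      "perfectly_matched E (U - {a, b, c, d, e})" for a b c d e
  proof -
    have "path_partitioned L E (set [a, b, c, d, e] \<union> (U - {a, b, c, d, e}))"
      using that L by (intro path_partitioned.path perfectly_matched_imp_path_partitioned)
        (auto simp: numeral_eq_Suc)
    moreover have "set [a, b, c, d, e] \<union> (U - {a, b, c, d, e}) = U" using that by auto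
    ultimately show ?thesis by simp
  qed
  obtain v where v: "v \<in> U" using card by (metis all_not_in_conv card.empty not_numeral_le_zero)
  have "card (U - {v}) \<noteq> 0" using card v by simp
  then have "U - {v} \<noteq> {}" by (metis card.empty)
  then obtain u where "u \<in> U - {v}" by blast
  then obtain x where x: "x \<in> U" "x \<noteq> v" "E v x"
    using perfectly_matched_partner[OF pm[of u], of v] v by auto
  then obtain y where y: "y \<in> U" "y \<noteq> v" "x \<noteq> y" "E x y" "perfectly_matched E (U - {v} - {x, y})"
    using perfectly_matched_partner[OF pm[OF v], of x] by auto
  \<comment> \<open>The matching that misses \<open>v\<close> consists of the edge from
    \<open>x\<close> to \<open>y\<close> and a matching of \<open>W\<close>. An edge from the triple
    into \<open>W\<close> can be prolonged by the matching edge at its end.\<close>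
  define W where "W = U - {v} - {x, y}"
  have W: "perfectly_matched E W" "U = {v, x, y} \<union> W" "W \<inter> {v, x, y} = {}"
    using y x v by (auto simp: W_def)
  have partner: "\<exists>t\<in>W. z \<noteq> t \<and> E z t \<and> perfectly_matched E (W - {z, t})" if "z \<in> W" for z
    using perfectly_matched_partner[OF W(1) that] .
  have remove: "U - {a, b, c, d, e} = W - {z, t}"
    if "{a, b, c, d, e} = {v, x, y, z, t}" for a b c d e z t
    using that W by auto
  show ?thesis
  proof (rule ccontr)
    assume none: "\<not> ?thesis"
    have v_out: "\<not> E v z" if "z \<in> W" for z
    proof
      assume "E v z"
      obtain t where t: "t \<in> W" "z \<noteq> t" "E z t" "perfectly_matched E (W - {z, t})" using partner[OF \<open>z \<in> W\<close>] by blast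
      have "path_partitioned L E U"
        using t that x y W E_sym \<open>E v z\<close> remove[of y x v z t z t] by (intro P5[of y x v z t]) auto
      then show False using none by contradiction
    qed
    have y_out: "\<not> E y z" if "z \<in> W" for z
    proof
      assume "E y z"
      obtain t where t: "t \<in> W" "z \<noteq> t" "E z t" "perfectly_matched E (W - {z, t})" using partner[OF \<open>z \<in> W\<close>] by blast
      have "path_partitioned L E U"
        using t that x y W E_sym \<open>E y z\<close> remove[of v x y z t z t] by (intro P5[of v x y z t]) auto
      then show False using none by contradiction
    qed
    \<comment> \<open>A matching that misses \<open>x\<close> must pair \<open>v\<close> with
      \<open>y\<close>. Hence the triple is a triangle, and a path through it may leave at
      \<open>x\<close> too.\<close>
    have "\<exists>t\<in>U - {x}. v \<noteq> t \<and> E v t" using perfectly_matched_partner[OF pm[OF x(1)], of v] v x by auto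
    then have "E v y" using v_out W by auto
    have x_out: "\<not> E x z" if "z \<in> W" for z
    proof
      assume "E x z"
      obtain t where t: "t \<in> W" "z \<noteq> t" "E z t" "perfectly_matched E (W - {z, t})" using partner[OF \<open>z \<in> W\<close>] by blast
      have "path_partitioned L E U"
        using t that x y W E_sym \<open>E x z\<close> \<open>E v y\<close> remove[of v y x z t z t]
        by (intro P5[of v y x z t]) auto
      then show False using none by contradiction
    qed
    have "W \<noteq> {}"
    proof
      assume "W = {}"
      then have "card U = 3" using W x y by auto
      then show False using card by simp
    qed
    \<comment> \<open>A matching that misses a vertex of \<open>W\<close> pairs \<open>v\<close>
      inside the triple, so the third vertex of the triple needs a partner in
      \<open>W\<close>.\<close>
    then obtain z where z: "z \<in> W" by blast
    then have "z \<in> U" "z \<noteq> v" using W by auto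
    then obtain p where p: "p \<in> U" "p \<noteq> v" "E v p" "perfectly_matched E (U - {z} - {v, p})"
      using perfectly_matched_partner[OF pm[of z], of v] v by auto
    then have "p = x \<or> p = y" using v_out W by auto
    define q where "q = (if p = x then y else x)"
    have q: "q \<in> U - {z} - {v, p}" "{v, x, y} = {v, p, q}"
      using x y z W \<open>p = x \<or> p = y\<close> by (auto simp: q_def)
    obtain r where "r \<in> U - {z} - {v, p}" "q \<noteq> r" "E q r"
      using perfectly_matched_partner[OF p(4) q(1)] by auto
    then have "r \<in> W" "E q r" using W q by auto
    then show False using x_out y_out by (auto simp: q_def split: if_splits)
  qed
qed

section \<open>Existence of a Gallai-Edmonds decomposition\<close>

text \<open>Disjoint odd closed sets each contain an odd component of \<open>U - T\<close>, so
  \<open>card P - card T\<close> is at most the deficiency from Berge's formula. Sets may be omitted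
  or merged freely, which makes modifying a family easy.\<close>

definition separated_odd_family :: "'a set \<Rightarrow> 'a set \<Rightarrow> 'a set set \<Rightarrow> bool" where
  "separated_odd_family U T P \<longleftrightarrow> T \<subseteq> U \<and> (\<forall>C\<in>P. odd (card C) \<and> closed_in E (U - T) C) \<and>
    (\<forall>C\<in>P. \<forall>D\<in>P. C \<noteq> D \<longrightarrow> C \<inter> D = {})"

definition gallai_edmonds :: "'a set \<Rightarrow> 'a set \<Rightarrow> 'a set set \<Rightarrow> ('a \<Rightarrow> 'a set) \<Rightarrow> bool" where
  "gallai_edmonds U T P M \<longleftrightarrow> T \<subseteq> U \<and> \<Union>P = U - T \<and>
    (\<forall>C\<in>P. factor_critical E C \<and> closed_in E (U - T) C) \<and>
    (\<forall>C\<in>P. \<forall>D\<in>P. C \<noteq> D \<longrightarrow> C \<inter> D = {}) \<and>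
    inj_on M T \<and> (\<forall>t\<in>T. M t \<in> P \<and> (\<exists>x\<in>M t. E t x))"

text \<open>\<open>M\<close> embeds \<open>T\<close> into \<open>P\<close>. If it were onto,
  absorbing every \<open>M t\<close> would match all of \<open>U\<close>; so there is a surplus, and
  parity makes it at least two.\<close>

lemma gallai_edmonds_deficiency:
  assumes "gallai_edmonds U T P M" "finite U" "even (card U)" "\<not> perfectly_matched E U"
  shows "card T + 2 \<le> card P"
proof -
  have T: "T \<subseteq> U" and P: "\<Union>P = U - T" "\<And>C. C \<in> P \<Longrightarrow> factor_critical E C"
    and disj: "\<And>C D. C \<in> P \<Longrightarrow> D \<in> P \<Longrightarrow> C \<noteq> D \<Longrightarrow> C \<inter> D = {}"
    and M: "inj_on M T" "\<And>t. t \<in> T \<Longrightarrow> M t \<in> P" "\<And>t. t \<in> T \<Longrightarrow> \<exists>x\<in>M t. E t x"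
    using assms(1) unfolding gallai_edmonds_def by auto
  have "P \<subseteq> Pow U" using P by auto
  then have fin: "finite P" "finite T" using assms(2) T finite_subset by blast+
  have "card T \<le> card P" using M fin by (intro card_inj_on_le[of M]) auto
  moreover have "card T \<noteq> card P"
  proof
    assume "card T = card P"
    then have "M ` T = P" using M fin by (intro card_subset_eq) (auto simp: card_image)
    moreover have "perfectly_matched E (T \<union> \<Union>(M ` T))"
    proof (rule perfectly_matched_absorb_critical)
      show "M s \<inter> M t = {}" if "s \<in> T" "t \<in> T" "s \<noteq> t" for s t
        using that M(1,2) disj by (metis inj_onD)
      show "\<Union>(M ` T) \<inter> T = {}" using \<open>M ` T = P\<close> P by auto
    qed (use fin M P in auto)
    ultimately show False using assms(4) P(1) T by (simp add: Un_absorb1 Un_commute)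
  qed
  moreover have "even (card T) \<longleftrightarrow> even (card P)"
  proof -
    have "even (card (\<Union>P)) \<longleftrightarrow> even (card P)"
      using fin(1) P(2)[THEN factor_critical_finite] P(2)[THEN factor_critical_odd] disj
      by (intro even_card_Union_odd) auto
    moreover have "card U = card T + card (\<Union>P)"
      using P T assms(2) fin by (simp add: card_Diff_subset card_mono)
    ultimately show ?thesis using assms(3) by simp
  qed
  ultimately show ?thesis by presburger
qed

text \<open>Choose a family with \<open>card P - card T\<close> maximal and, subject to that,
  \<open>card T\<close> maximal: the failure of any required property would give a better family.
  The induction on \<open>card U\<close> supplies decompositions of the sets \<open>C - {c}\<close>
  when factor-criticality is proved.\<close>

lemma gallai_edmonds_exists:
  assumes "finite U"
  shows "\<exists>T P M. gallai_edmonds U T P M"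
  using assms
proof (induction "card U" arbitrary: U rule: less_induct)
  case less
  note finU = less.prems
  \<comment> \<open>\<open>?f\<close> encodes the lexicographic order on the pairs \<open>(|P| - |T|, |T|)\<close>.\<close>
  let ?sep = "\<lambda>(T, P). separated_odd_family U T P"
  let ?k = "\<lambda>T P :: 'a set set. card P + card U - card T"
  let ?f = "\<lambda>(T, P). ?k T P * Suc (card U) + card T"
  have sepD: "T \<subseteq> U" "P \<subseteq> Pow U" if "separated_odd_family U T P" for T P
    using that by (auto simp: separated_odd_family_def closed_in_def)
  have "?sep ({}, {})" by (simp add: separated_odd_family_def)
  moreover have "\<forall>TP. ?sep TP \<longrightarrow> ?f TP < Suc ((card (Pow U) + card U) * Suc (card U) + card U)"
  proof (intro allI impI, clarify)
    fix T P assume "separated_odd_family U T P"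
    from sepD[OF this] have "card P \<le> card (Pow U)" "card T \<le> card U"
      using finU by (simp_all add: card_mono del: card_Pow)
    then show "?k T P * Suc (card U) + card T < Suc ((card (Pow U) + card U) * Suc (card U) + card U)"
      unfolding less_Suc_eq_le by (intro add_mono mult_le_mono) auto
  qed
  ultimately have "\<exists>TP. ?sep TP \<and> (\<forall>TP'. ?sep TP' \<longrightarrow> ?f TP' \<le> ?f TP)"
    by (rule ex_has_greatest_nat[where P = ?sep and k = "({}, {})" and f = ?f])
  then obtain TP where TP: "?sep TP" "\<forall>TP'. ?sep TP' \<longrightarrow> ?f TP' \<le> ?f TP" by blast
  obtain T P where "TP = (T, P)" by (cases TP)
  with TP have sep: "separated_odd_family U T P"
    and max: "\<And>T' P'. separated_odd_family U T' P' \<Longrightarrow>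
      ?k T' P' * Suc (card U) + card T' \<le> ?k T P * Suc (card U) + card T" by auto
  \<comment> \<open>Maximality without its encoding: a family with at least the same surplus has the
    same surplus and no larger separator. The bounds by \<open>card U\<close> make the subtraction
    in \<open>?k\<close> exact.\<close>
  have optimal: "card P + card T' = card P' + card T \<and> card T' \<le> card T"
    if sep': "separated_odd_family U T' P'" and le: "card P + card T' \<le> card P' + card T" for T' P'
  proof -
    have T: "card T \<le> card U" "card T' \<le> card U"
      using sepD(1)[OF sep] sepD(1)[OF sep'] finU by (simp_all add: card_mono)
    then have k: "?k T P \<le> ?k T' P'" using le by linarith
    moreover have "\<not> Suc (?k T P) \<le> ?k T' P'"
    proof
      assume "Suc (?k T P) \<le> ?k T' P'"
      then have "Suc (?k T P) * Suc (card U) \<le> ?k T' P' * Suc (card U)" by (rule mult_le_mono1)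
      then show False using max[OF sep'] T by simp
    qed
    ultimately have "?k T P = ?k T' P'" by linarith
    then show ?thesis using max[OF sep'] T by auto
  qed
  have TU: "T \<subseteq> U" and odd: "\<And>C. C \<in> P \<Longrightarrow> odd (card C)"
    and sub: "\<And>C. C \<in> P \<Longrightarrow> C \<subseteq> U - T"
    and cl: "\<And>C x y. C \<in> P \<Longrightarrow> x \<in> C \<Longrightarrow> y \<in> U - T - C \<Longrightarrow> \<not> E x y"
    and disj: "\<And>C D. C \<in> P \<Longrightarrow> D \<in> P \<Longrightarrow> C \<noteq> D \<Longrightarrow> C \<inter> D = {}"
    using sep by (auto simp: separated_odd_family_def closed_in_def)
  have finT: "finite T" and finP: "finite P"
    using sepD[OF sep] finU finite_subset by blast+
  have cover: "\<Union>P = U - T"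
  proof (rule ccontr)
    assume "\<Union>P \<noteq> U - T"
    define R where "R = U - T - \<Union>P"
    have R: "R \<noteq> {}" "R \<subseteq> U - T" "R \<inter> \<Union>P = {}" using \<open>\<Union>P \<noteq> U - T\<close> sub by (auto simp: R_def)
    then obtain r where r: "r \<in> R" by blast
    have finR: "finite R" using finU by (simp add: R_def)
    have cl_R: "\<not> E x y" if xy: "x \<in> R" "y \<in> U - T - R" for x y
    proof
      assume "E x y"
      obtain C where C: "C \<in> P" "y \<in> C" using xy(2) by (auto simp: R_def)
      then have "x \<in> U - T - C" using xy(1) by (auto simp: R_def)
      then show False using cl[OF C] E_sym[OF \<open>E x y\<close>] by blast
    qed
    show False
    proof (cases "odd (card R)")
      case True
      have "separated_odd_family U T (insert R P)"
        unfolding separated_odd_family_def closed_in_def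
      proof (intro conjI ballI impI)
        fix C assume C: "C \<in> insert R P"
        then show "odd (card C)" using odd True by auto
        show "C \<subseteq> U - T" using C sub[of C] R by auto
        fix x y assume "x \<in> C" "y \<in> U - T - C"
        then show "\<not> E x y" using C cl[of C x y] cl_R[of x y] by auto
      next
        fix C D assume "C \<in> insert R P" "D \<in> insert R P" "C \<noteq> D"
        then show "C \<inter> D = {}" using disj[of C D] R(3) by (elim insertE) blast+
      qed (rule TU)
      moreover have "card (insert R P) = card P + 1"
        using finP R by (subst card_insert_disjoint) auto
      ultimately show False using optimal[of T "insert R P"] by auto
    next
      case False
      \<comment> \<open>With \<open>r\<close> in the separator and the odd rest of \<open>R\<close>
        in the family, the surplus is unchanged but the separator grows.\<close>
      then have odd_R: "odd (card (R - {r}))" using finR r by (auto simp: card_gt_0_iff)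
      then have R_ne: "R - {r} \<noteq> {}" by (metis card.empty even_zero)
      have "separated_odd_family U (insert r T) (insert (R - {r}) P)"
        unfolding separated_odd_family_def closed_in_def
      proof (intro conjI ballI impI)
        show "insert r T \<subseteq> U" using r R TU by auto
      next
        fix C assume "C \<in> insert (R - {r}) P"
        then show "odd (card C)" using odd odd_R by auto
        show "C \<subseteq> U - insert r T" using \<open>C \<in> insert (R - {r}) P\<close> sub[of C] R r by auto
        fix x y assume "x \<in> C" "y \<in> U - insert r T - C"
        then show "\<not> E x y" using \<open>C \<in> insert (R - {r}) P\<close> cl[of C x y] cl_R[of x y] by auto
      next
        fix C D assume "C \<in> insert (R - {r}) P" "D \<in> insert (R - {r}) P" "C \<noteq> D"
        then show "C \<inter> D = {}" using disj[of C D] R(3) by (elim insertE) blast+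
      qed
      moreover have "card (insert (R - {r}) P) = card P + 1"
        using finP R R_ne by (subst card_insert_disjoint) auto
      moreover have "card (insert r T) = card T + 1"
        using finT r R by (subst card_insert_disjoint) auto
      ultimately show False using optimal[of "insert r T" "insert (R - {r}) P"] by simp
    qed
  qed
  have crit: "factor_critical E C" if C: "C \<in> P" for C
    unfolding factor_critical_def
  proof (intro conjI ballI)
    show "C \<noteq> {}" using odd[OF C] by auto
    fix c assume c: "c \<in> C"
    have finC: "finite C" using finU sub[OF C] finite_subset by blast
    show "perfectly_matched E (C - {c})"
    proof (rule ccontr)
      assume no: "\<not> ?thesis"
      have "card (C - {c}) < card U"
        using finU sub[OF C] c by (intro psubset_card_mono) auto
      then obtain T1 P1 M1 where ge: "gallai_edmonds (C - {c}) T1 P1 M1"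
        using less.hyps finC by blast
      have "even (card (C - {c}))" using odd[OF C] c finC by simp
      then have def1: "card T1 + 2 \<le> card P1"
        using gallai_edmonds_deficiency[OF ge] finC no by simp
      have T1: "T1 \<subseteq> C - {c}" and P1: "\<And>D. D \<in> P1 \<Longrightarrow> D \<subseteq> C - {c} - T1"
          "\<And>D. D \<in> P1 \<Longrightarrow> odd (card D)"
        and cl1: "\<And>D x y. D \<in> P1 \<Longrightarrow> x \<in> D \<Longrightarrow> y \<in> C - {c} - T1 - D \<Longrightarrow> \<not> E x y"
        and disj1: "\<And>D D'. D \<in> P1 \<Longrightarrow> D' \<in> P1 \<Longrightarrow> D \<noteq> D' \<Longrightarrow> D \<inter> D' = {}"
        using ge factor_critical_odd[of E] by (auto simp: gallai_edmonds_def closed_in_def)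
      \<comment> \<open>\<open>C\<close> is replaced by the \<open>card P1\<close> parts of
        \<open>C - {c}\<close>, and the separator gains \<open>card T1 + 1\<close> vertices. As
        \<open>card P1\<close> is at least \<open>card T1 + 2\<close>, the surplus does not drop
        although the separator grows.\<close>
      let ?T = "insert c (T \<union> T1)" and ?P = "(P - {C}) \<union> P1"
      have "separated_odd_family U ?T ?P"
        unfolding separated_odd_family_def closed_in_def
      proof (intro conjI ballI impI)
        show "?T \<subseteq> U" using TU T1 sub[OF C] c by auto
      next
        fix D assume D: "D \<in> ?P"
        then show "odd (card D)" using odd P1 by auto
        consider "D \<in> P1" | "D \<in> P" "D \<inter> C = {}" using D disj[of D C] C by blast
        then have D': "D \<subseteq> U - ?T \<and> (\<forall>x\<in>D. \<forall>y\<in>U - ?T - D. \<not> E x y)"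
        proof cases
          case 1
          have "\<not> E x y" if "x \<in> D" "y \<in> U - ?T - D" for x y
            using that cl1[OF 1 that(1), of y] cl[OF C, of x y] P1[OF 1] by auto
          then show ?thesis using P1[OF 1] sub[OF C] by blast
        next
          case 2
          then show ?thesis using sub[OF 2(1)] cl[OF 2(1)] T1 c by blast
        qed
        then show "D \<subseteq> U - ?T" by blast
        fix x y assume "x \<in> D" "y \<in> U - ?T - D"
        then show "\<not> E x y" using D' by blast
      next
        fix D D' assume "D \<in> ?P" "D' \<in> ?P" "D \<noteq> D'"
        moreover have "F \<inter> F' = {}" if "F \<in> P - {C}" "F' \<in> P1" for F F'
          using disj[of F C] that C P1(1)[of F'] by blast
        ultimately show "D \<inter> D' = {}" using disj[of D D'] disj1[of D D'] by blast
      qed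
      moreover have "card ?P + 1 = card P + card P1"
      proof -
        have "finite P1" using def1 card.infinite by fastforce
        moreover have "(P - {C}) \<inter> P1 = {}"
        proof -
          have False if "F \<in> P - {C}" "F \<in> P1" for F
          proof -
            have "F \<inter> C = {}" using that(1) disj[of F C] C by auto
            then have "F = {}" using P1(1)[OF that(2)] by auto
            then show False using P1(2)[OF that(2)] by simp
          qed
          then show ?thesis by blast
        qed
        ultimately have "card ?P = card (P - {C}) + card P1" using finP by (intro card_Un_disjoint) auto
        moreover have "card P = Suc (card (P - {C}))" using C finP by (metis card_Suc_Diff1)
        ultimately show ?thesis by simp
      qed
      moreover have "card ?T = card T + card T1 + 1"
      proof -
        have "finite T1" using T1 finC finite_subset by blast
        moreover have "card (T \<union> T1) = card T + card T1"
          using finT calculation T1 sub[OF C] by (intro card_Un_disjoint) auto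
        ultimately show ?thesis using finT T1 c sub[OF C] by (subst card_insert_disjoint) auto
      qed
      ultimately show False using optimal[of ?T ?P] def1 by linarith
    qed
  qed
  define N where "N t = {C \<in> P. \<exists>x\<in>C. E t x}" for t
  have "\<exists>M. inj_on M T \<and> (\<forall>t\<in>T. M t \<in> N t)"
  proof (rule hall_marriage)
    fix Y assume Y: "Y \<subseteq> T"
    show "card Y \<le> card (\<Union>(N ` Y))"
    proof (rule ccontr)
      assume "\<not> ?thesis"
      have sub_P: "\<Union>(N ` Y) \<subseteq> P" by (auto simp: N_def)
      \<comment> \<open>Dropping a violator \<open>Y\<close> of Hall's condition together with all
        adjacent parts raises the surplus; the remaining parts stay closed because they have no
        neighbours in \<open>Y\<close>.\<close>
      have "separated_odd_family U (T - Y) (P - \<Union>(N ` Y))"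
        unfolding separated_odd_family_def closed_in_def
      proof (intro conjI ballI impI)
        fix C assume C: "C \<in> P - \<Union>(N ` Y)"
        fix x y assume "x \<in> C" "y \<in> U - (T - Y) - C"
        then show "\<not> E x y" using C cl[of C x y] E_sym[of x y] by (auto simp: N_def)
      qed (use TU odd sub disj Y in auto)
      moreover have "card (P - \<Union>(N ` Y)) + card (\<Union>(N ` Y)) = card P"
        using sub_P finP by (simp add: card_Diff_subset card_mono finite_subset)
      moreover have "card (T - Y) + card Y = card T"
        using Y finT by (simp add: card_Diff_subset card_mono finite_subset)
      ultimately show False
        using optimal[of "T - Y" "P - \<Union>(N ` Y)"] \<open>\<not> card Y \<le> card (\<Union>(N ` Y))\<close> by linarith
    qed
  qed (use finT finP in \<open>auto simp: N_def\<close>)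
  then obtain M where "inj_on M T" "\<forall>t\<in>T. M t \<in> N t" by blast
  then have "gallai_edmonds U T P M"
    unfolding gallai_edmonds_def closed_in_def N_def using TU cover crit sub cl disj by auto
  then show ?case by blast
qed

section \<open>From tilings to path partitions\<close>

text \<open>For \<open>i = 1\<close> and \<open>i = 3\<close> these are the isolated vertices and
  the triangle components. Components that are paths on three vertices are not included.\<close>

definition critical_parts :: "'a set \<Rightarrow> nat \<Rightarrow> 'a set set" where
  "critical_parts U i = {C. factor_critical E C \<and> closed_in E U C \<and> card C = i}"

text \<open>Deleting \<open>z\<close> forces the edge from \<open>x\<close> to \<open>y\<close>, and
  deleting \<open>x\<close> the one from \<open>y\<close> to \<open>z\<close>. The result is a
  spanning path that starts at the prescribed vertex \<open>x\<close>.\<close>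

lemma triangle:
  assumes "factor_critical E C" "card C = 3" "x \<in> C"
  shows "\<exists>y z. C = {x, y, z} \<and> x \<noteq> y \<and> y \<noteq> z \<and> x \<noteq> z \<and> E x y \<and> E y z"
proof -
  obtain y z where C: "C = {x, y, z}" "x \<noteq> y" "y \<noteq> z" "x \<noteq> z"
    using assms(2,3) by (auto simp: card_3_iff)
  have "perfectly_matched E (C - {z})" "perfectly_matched E (C - {x})"
    using assms(1) C by (auto simp: factor_critical_def)
  moreover have "C - {z} = {x, y}" "C - {x} = {y, z}" using C by auto
  ultimately have "E x y" "E y z"
    using perfectly_matched_partner[of "{x, y}" x] perfectly_matched_partner[of "{y, z}" y] by auto
  then show ?thesis using C by blast
qed

text \<open>Each tile becomes one path through its vertices in \<open>A\<close>, on two vertices for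
  an edge and on five otherwise. A component entered at one end of the path, except the triangle of
  a cherry, keeps a perfect matching of its other vertices.\<close>

lemma tiled_path_partitioned:
  assumes "tiled N w A S" and L: "2 \<in> L" "5 \<in> L"
    and "\<forall>C\<in>S. factor_critical E C" and "pairwise disjnt S" and "disjnt A (\<Union>S)"
    and N: "\<And>C a. a \<in> N C \<Longrightarrow> \<exists>x\<in>C. E a x"
    and w: "\<And>C. w C = 3 \<Longrightarrow> card C = 1" "\<And>C. w C = 2 \<Longrightarrow> card C = 3"
  shows "path_partitioned L E (A \<union> \<Union>S)"
  using assms(1,4-6)
proof induction
  case empty
  show ?case by (simp add: path_partitioned.empty)
next
  case (edge A S a s)
  obtain x where x: "x \<in> s" "E a x" using N[OF edge.hyps(4)] by blast
  have disj: "disjnt s (\<Union>S)" "disjnt A s" "disjnt A (\<Union>S)" "a \<notin> s" "a \<notin> \<Union>S"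
    using disjnt_Union_if_pairwise[OF edge.prems(2) edge.hyps(3)] edge.prems(3)
    by (auto simp: disjnt_def)
  have "path_partitioned L E (A \<union> \<Union>S)"
    using edge.IH edge.prems disj by (simp add: pairwise_insert)
  moreover have "perfectly_matched E (s - {x})"
    using edge.prems(1) x by (simp add: factor_critical_def)
  then have "path_partitioned L E (set [a, x] \<union> (s - {x}))"
    using disj x L by (intro path_partitioned.path perfectly_matched_imp_path_partitioned)
      (auto simp: numeral_eq_Suc)
  moreover have "set [a, x] \<union> (s - {x}) = insert a s" using x by auto
  moreover have "insert a s \<inter> (A \<union> \<Union>S) = {}" using disj edge.hyps by (auto simp: disjnt_def)
  ultimately have "path_partitioned L E (insert a s \<union> (A \<union> \<Union>S))"
    by (metis path_partitioned_Un)
  moreover have "insert a s \<union> (A \<union> \<Union>S) = insert a A \<union> \<Union>(insert s S)" by auto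
  ultimately show ?case by metis
next
  case (cherry A S a s t)
  obtain x where x: "x \<in> s" "E a x" using N[OF cherry.hyps(6)] by blast
  obtain y where y: "y \<in> t" "E a y" using N[OF cherry.hyps(7)] by blast
  have "factor_critical E t" using cherry.prems(1) by simp
  from triangle[OF this w(2)[OF cherry.hyps(8)] y(1)]
  obtain y1 y2 where t: "t = {y, y1, y2}" "y \<noteq> y1" "y1 \<noteq> y2" "y \<noteq> y2" "E y y1" "E y1 y2"
    by blast
  have disj: "disjnt s (\<Union>S)" "disjnt t (\<Union>S)" "disjnt A s" "disjnt A t" "disjnt A (\<Union>S)"
    "disjnt s t" "a \<notin> s" "a \<notin> t" "a \<notin> \<Union>S"
  proof -
    have "s \<notin> insert t S" using cherry.hyps by simp
    note disjnt_Union_if_pairwise[OF cherry.prems(2) this]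
      disjnt_Union_if_pairwise[OF pairwise_subset[OF cherry.prems(2) subset_insertI] cherry.hyps(4)]
      cherry.prems(3)
    then show "disjnt s (\<Union>S)" "disjnt t (\<Union>S)" "disjnt A s" "disjnt A t" "disjnt A (\<Union>S)"
      "disjnt s t" "a \<notin> s" "a \<notin> t" "a \<notin> \<Union>S"
      by (simp_all add: disjnt_insert1 disjnt_Un2)
  qed
  have "path_partitioned L E (A \<union> \<Union>S)"
    using cherry.IH cherry.prems disj by (simp add: pairwise_insert)
  moreover have "perfectly_matched E (s - {x})"
    using cherry.prems(1) x by (simp add: factor_critical_def)
  \<comment> \<open>The weight 2 of \<open>t\<close> makes it a triangle, which the path sweeps up
    entirely.\<close>
  then have "path_partitioned L E (set [x, a, y, y1, y2] \<union> (s - {x}))"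
    using disj x y t L E_sym[OF x(2)]
    by (intro path_partitioned.path perfectly_matched_imp_path_partitioned)
      (auto simp: numeral_eq_Suc disjnt_def)
  moreover have "set [x, a, y, y1, y2] \<union> (s - {x}) = insert a (s \<union> t)" using x t by auto
  moreover have "insert a (s \<union> t) \<inter> (A \<union> \<Union>S) = {}"
    using disj cherry.hyps(2) by (auto simp: disjnt_def)
  ultimately have "path_partitioned L E (insert a (s \<union> t) \<union> (A \<union> \<Union>S))"
    by (metis path_partitioned_Un)
  moreover have "insert a (s \<union> t) \<union> (A \<union> \<Union>S) = insert a A \<union> \<Union>(insert s (insert t S))"
    by auto
  ultimately show ?case by metis
next
  case (zigzag A S a b s t r)
  obtain x where x: "x \<in> s" "E a x" using N[OF zigzag.hyps(11)] by blast
  obtain y where t: "t = {y}" using w(1)[OF zigzag.hyps(15)] by (auto simp: card_1_singleton_iff)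
  have y: "E a y" "E b y" using N[OF zigzag.hyps(12)] N[OF zigzag.hyps(13)] t by auto
  obtain z where z: "z \<in> r" "E b z" using N[OF zigzag.hyps(14)] by blast
  have disj: "disjnt s (\<Union>S)" "disjnt t (\<Union>S)" "disjnt r (\<Union>S)" "disjnt A s" "disjnt A t"
    "disjnt A r" "disjnt A (\<Union>S)" "disjnt s t" "disjnt s r" "disjnt t r"
    "a \<notin> s" "a \<notin> t" "a \<notin> r" "a \<notin> \<Union>S" "b \<notin> s" "b \<notin> t" "b \<notin> r" "b \<notin> \<Union>S"
  proof -
    have s: "s \<notin> insert t (insert r S)" and t: "t \<notin> insert r S" using zigzag.hyps by auto
    have pw: "pairwise disjnt (insert t (insert r S))" "pairwise disjnt (insert r S)"
      using zigzag.prems(2) by (auto elim: pairwise_subset)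
    note disjnt_Union_if_pairwise[OF zigzag.prems(2) s] disjnt_Union_if_pairwise[OF pw(1) t]
      disjnt_Union_if_pairwise[OF pw(2) zigzag.hyps(7)] zigzag.prems(3)
    then show "disjnt s (\<Union>S)" "disjnt t (\<Union>S)" "disjnt r (\<Union>S)" "disjnt A s" "disjnt A t"
      "disjnt A r" "disjnt A (\<Union>S)" "disjnt s t" "disjnt s r" "disjnt t r"
      "a \<notin> s" "a \<notin> t" "a \<notin> r" "a \<notin> \<Union>S" "b \<notin> s" "b \<notin> t" "b \<notin> r" "b \<notin> \<Union>S"
      by (simp_all add: disjnt_insert1 disjnt_Un2)
  qed
  have "path_partitioned L E (A \<union> \<Union>S)"
    using zigzag.IH zigzag.prems disj by (simp add: pairwise_insert)
  moreover have "perfectly_matched E ((s - {x}) \<union> (r - {z}))"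
    using zigzag.prems(1) x z disj
    by (intro perfectly_matched_Un) (auto simp: factor_critical_def disjnt_def)
  \<comment> \<open>The middle component is the singleton \<open>{y}\<close>, so the path passes
    through it and leaves nothing behind.\<close>
  then have "path_partitioned L E (set [x, a, y, b, z] \<union> ((s - {x}) \<union> (r - {z})))"
    using disj x y z t L zigzag.hyps(4) E_sym[OF x(2)] E_sym[OF y(2)]
    by (intro path_partitioned.path perfectly_matched_imp_path_partitioned)
      (auto simp: numeral_eq_Suc disjnt_def)
  moreover have "set [x, a, y, b, z] \<union> ((s - {x}) \<union> (r - {z})) = insert a (insert b (s \<union> t \<union> r))"
    using x z t by auto
  moreover have "insert a (insert b (s \<union> t \<union> r)) \<inter> (A \<union> \<Union>S) = {}"
    using disj zigzag.hyps(2,3) by (auto simp: disjnt_def)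
  ultimately have "path_partitioned L E (insert a (insert b (s \<union> t \<union> r)) \<union> (A \<union> \<Union>S))"
    by (metis path_partitioned_Un)
  moreover have "insert a (insert b (s \<union> t \<union> r)) \<union> (A \<union> \<Union>S)
      = insert a (insert b A) \<union> \<Union>(insert s (insert t (insert r S)))" by auto
  ultimately show ?case by metis
qed

theorem path_partitioned_if_deficiency_bound:
  assumes finU: "finite U"
    and bound: "\<And>X. X \<subseteq> U \<Longrightarrow>
      3 * card (critical_parts (U - X) 1) + 2 * card (critical_parts (U - X) 3) \<le> 4 * card X + 1"
  shows "path_partitioned {2, 5} E U"
proof -
  obtain T P M where "gallai_edmonds U T P M" using gallai_edmonds_exists[OF finU] by blast
  then have T: "T \<subseteq> U" and P: "\<Union>P = U - T" "\<And>C. C \<in> P \<Longrightarrow> factor_critical E C"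
    and cl: "\<And>C. C \<in> P \<Longrightarrow> closed_in E (U - T) C"
    and disj: "\<And>C D. C \<in> P \<Longrightarrow> D \<in> P \<Longrightarrow> C \<noteq> D \<Longrightarrow> C \<inter> D = {}"
    and M: "inj_on M T" "\<And>t. t \<in> T \<Longrightarrow> M t \<in> P" "\<And>t. t \<in> T \<Longrightarrow> \<exists>x\<in>M t. E t x"
    unfolding gallai_edmonds_def by auto
  have "P \<subseteq> Pow U" using P by auto
  then have fin: "finite P" "finite T" using finU T finite_subset by blast+
  define N where "N C = {t \<in> T. \<exists>x\<in>C. E t x}" for C
  \<comment> \<open>The default 0 makes the weights 3 and 2 determine the cardinality, as the
    conversion of tiles into paths requires.\<close>
  define w :: "'a set \<Rightarrow> nat" where "w C = (if card C = 1 then 3 else if card C = 3 then 2 else 0)" for C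
  define S where "S = {C \<in> P. card C = 1 \<or> card C = 3}"
  have "\<exists>A'\<subseteq>T. tiled N w A' S"
  proof (rule tiling_exists)
    fix Y assume Y: "Y \<subseteq> T"
    let ?S = "\<lambda>i. {C \<in> enclosed N S Y. card C = i}"
    have sub: "?S i \<subseteq> critical_parts (U - Y) i" for i
    proof
      fix C assume "C \<in> ?S i"
      then have C: "C \<in> P" "N C \<subseteq> Y" "card C = i" by (auto simp: enclosed_def S_def)
      \<comment> \<open>A part whose neighbours in \<open>T\<close> all lie in \<open>Y\<close>
        remains closed when only \<open>Y\<close> is deleted, so the hypothesis for \<open>Y\<close>
        counts it.\<close>
      have "closed_in E (U - Y) C"
        using cl[OF C(1)] C(2) Y E_sym unfolding closed_in_def N_def by fast
      then show "C \<in> critical_parts (U - Y) i" using C P by (simp add: critical_parts_def)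
    qed
    have finc: "finite (critical_parts (U - Y) i)" for i
      by (rule finite_subset[of _ "Pow U"]) (use finU in \<open>auto simp: critical_parts_def closed_in_def\<close>)
    have "enclosed N S Y = ?S 1 \<union> ?S 3" by (auto simp: enclosed_def S_def)
    moreover have finS: "finite (?S i)" for i using fin by (simp add: S_def)
    moreover have "sum w (?S 1 \<union> ?S 3) = sum w (?S 1) + sum w (?S 3)"
      using finS by (intro sum.union_disjoint) auto
    moreover have "sum w (?S 1) = 3 * card (?S 1)" "sum w (?S 3) = 2 * card (?S 3)"
      by (simp_all add: w_def)
    moreover have "card (?S 1) \<le> card (critical_parts (U - Y) 1)"
        "card (?S 3) \<le> card (critical_parts (U - Y) 3)"
      using card_mono[OF finc sub] by blast+
    moreover have "3 * card (critical_parts (U - Y) 1) + 2 * card (critical_parts (U - Y) 3)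
        \<le> 4 * card Y + 1"
      using Y T by (intro bound) auto
    ultimately show "sum w (enclosed N S Y) \<le> 4 * card Y + 1" by (simp only:)
  qed (use fin in \<open>auto simp: S_def w_def N_def\<close>)
  then obtain A' where A': "A' \<subseteq> T" "tiled N w A' S" by blast
  have "t \<in> N (M t)" if "t \<in> T" for t using M(3)[OF that] that by (simp add: N_def)
  \<comment> \<open>Absorbing the matching \<open>M\<close> covers the rest of \<open>T\<close>,
    possibly at the cost of larger parts, while all small parts stay covered.\<close>
  then obtain A S' where "tiled N w A S'" "T \<subseteq> A" "A \<subseteq> A' \<union> T" and S: "S \<subseteq> S'" "S' \<subseteq> S \<union> M ` T"
    using tiled_absorb_matching[OF fin(2) A'(2) M(1)] by blast
  moreover from this have "A = T" using A' by auto
  ultimately have tiled: "tiled N w T S'" by simp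
  have S'P: "S' \<subseteq> P" using S M by (auto simp: S_def)
  have part1: "path_partitioned {2, 5} E (T \<union> \<Union>S')"
  proof (rule tiled_path_partitioned[OF tiled])
    show "\<forall>C\<in>S'. factor_critical E C" using S'P P by blast
    show "pairwise disjnt S'" using S'P disj by (auto simp: pairwise_def disjnt_def)
    show "disjnt T (\<Union>S')" using S'P P by (auto simp: disjnt_def)
  qed (auto simp: N_def w_def split: if_splits)
  have part2: "path_partitioned {2, 5} E (\<Union>(P - S'))"
  proof (rule path_partitioned_Union)
    fix C assume C: "C \<in> P - S'"
    then have "card C \<noteq> 1" "card C \<noteq> 3" using S by (auto simp: S_def)
    moreover have "odd (card C)" using C P(2)[of C] factor_critical_odd[of E C] by auto
    ultimately have "4 \<le> card C" by presburger
    then show "path_partitioned {2, 5} E C" using C P by (intro factor_critical_path_partitioned) auto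
  qed (use fin disj in auto)
  have "\<Union>S' \<inter> \<Union>(P - S') = {}"
  proof -
    have "C \<inter> D = {}" if "C \<in> S'" "D \<in> P - S'" for C D using that disj[of C D] S'P by blast
    then show ?thesis by blast
  qed
  then have "path_partitioned {2, 5} E ((T \<union> \<Union>S') \<union> \<Union>(P - S'))"
    using P S'P by (intro path_partitioned_Un part1 part2) auto
  moreover have "\<Union>S' \<union> \<Union>(P - S') = \<Union>P" using S'P by blast
  then have "(T \<union> \<Union>S') \<union> \<Union>(P - S') = U" using P(1) T by blast
  ultimately show ?thesis by simp
qed

end

section \<open>Path factors of digraphs\<close>

lemma sccs_verts_closedI:
  assumes "wf_digraph H" "S \<noteq> {}" "\<And>u v. u \<in> S \<Longrightarrow> v \<in> S \<Longrightarrow> u \<rightarrow>\<^sup>*\<^bsub>H\<^esub> v"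
    and closed: "\<And>u v. u \<in> S \<Longrightarrow> u \<rightarrow>\<^bsub>H\<^esub> v \<Longrightarrow> v \<in> S"
  shows "S \<in> pre_digraph.sccs_verts H"
proof -
  interpret wf_digraph H by fact
  have "v \<in> S" if "u \<rightarrow>\<^sup>*\<^bsub>H\<^esub> v" "u \<in> S" for u v
    using that by (induction rule: reachable_induct) (auto intro: closed)
  then show ?thesis using assms(2,3) unfolding in_sccs_verts_conv_reachable by blast
qed

text \<open>\<open>num_components\<close> counts subgraphs, and a vertex set is recovered from the
  subgraph it induces. Finiteness of \<open>sccs\<close> is proved first because \<open>card\<close>
  is 0 on infinite sets.\<close>

lemma card_sccs_verts_le_num_components:
  assumes "fin_digraph H" and "\<C> \<subseteq> pre_digraph.sccs_verts H" "\<And>C. C \<in> \<C> \<Longrightarrow> card C = i"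
  shows "card \<C> \<le> num_components i H"
proof -
  interpret fin_digraph H by fact
  have "sccs \<subseteq> induce_subgraph H ` Pow (verts H)"
  proof
    fix C assume "C \<in> sccs"
    then have ind: "induced_subgraph C H" by (rule in_sccs_imp_induced)
    then have "verts C \<subseteq> verts H" by auto
    then show "C \<in> induce_subgraph H ` Pow (verts H)"
      using induce_eq_iff_induced[OF ind] by (metis PowI image_eqI)
  qed
  then have "finite sccs" by (rule finite_subset) simp
  moreover have "inj_on (induce_subgraph H) \<C>"
    by (rule inj_on_inverseI[of _ verts]) simp
  moreover have "induce_subgraph H ` \<C> \<subseteq> {C \<in> sccs. card (verts C) = i}"
    using assms(2,3) in_verts_sccsD_sccs by auto
  ultimately show ?thesis unfolding num_components_def by (intro card_inj_on_le) auto
qed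

section \<open>Path partitions as path factors\<close>

text \<open>The arcs are transported along the enumeration of \<open>p\<close>, so that
  \<open>nth p\<close> is an isomorphism almost by definition.\<close>

definition path_arcs :: "'a list \<Rightarrow> ('a \<times> 'a) set" where
  "path_arcs p = map_prod (nth p) (nth p) ` parcs (path_graph (length p))"

lemma in_path_arcs_iff:
  "(u, v) \<in> path_arcs p \<longleftrightarrow>
    (\<exists>i. Suc i < length p \<and> (u = p ! i \<and> v = p ! Suc i \<or> u = p ! Suc i \<and> v = p ! i))"
proof
  assume "(u, v) \<in> path_arcs p"
  then show "\<exists>i. Suc i < length p \<and> (u = p ! i \<and> v = p ! Suc i \<or> u = p ! Suc i \<and> v = p ! i)"
    by (auto simp: path_arcs_def path_graph_def)
next
  assume "\<exists>i. Suc i < length p \<and> (u = p ! i \<and> v = p ! Suc i \<or> u = p ! Suc i \<and> v = p ! i)"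
  then obtain i where i: "Suc i < length p"
    and uv: "(u, v) = (p ! i, p ! Suc i) \<or> (u, v) = (p ! Suc i, p ! i)" by blast
  have "(i, Suc i) \<in> parcs (path_graph (length p))" "(Suc i, i) \<in> parcs (path_graph (length p))"
    using i by (auto simp: path_graph_def)
  from this[THEN imageI[where f = "map_prod (nth p) (nth p)"]]
  have "(p ! i, p ! Suc i) \<in> path_arcs p" "(p ! Suc i, p ! i) \<in> path_arcs p"
    by (simp_all add: path_arcs_def)
  then show "(u, v) \<in> path_arcs p" using uv by metis
qed

lemma path_arcs_in_set: "(u, v) \<in> path_arcs p \<Longrightarrow> u \<in> set p \<and> v \<in> set p"
  by (auto simp: in_path_arcs_iff)

lemma path_graph_iso:
  assumes "distinct p"
  shows "digraph_iso \<lparr>verts = set p, arcs = path_arcs p, tail = fst, head = snd\<rparr>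
    (with_proj (path_graph (length p)))"
proof (rule digraph_iso_swap)
  let ?P = "with_proj (path_graph (length p))"
  let ?h = "\<lparr>iso_verts = nth p, iso_arcs = map_prod (nth p) (nth p), iso_head = snd, iso_tail = fst\<rparr>"
  show wf: "wf_digraph ?P" by unfold_locales (auto simp: path_graph_def)
  have inj: "inj_on (nth p) {..<length p}" using assms by (auto simp: inj_on_nth)
  have "parcs (path_graph (length p)) \<subseteq> {..<length p} \<times> {..<length p}" by (auto simp: path_graph_def)
  then have "inj_on (map_prod (nth p) (nth p)) (parcs (path_graph (length p)))"
    by (rule inj_on_subset[OF map_prod_inj_on[OF inj inj]])
  then have "pre_digraph.digraph_isomorphism ?P ?h"
    using wf inj by (auto simp: pre_digraph.digraph_isomorphism_def path_graph_def)
  moreover have "set p = nth p ` {..<length p}" by (auto simp: set_conv_nth)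
  then have "\<lparr>verts = set p, arcs = path_arcs p, tail = fst, head = snd\<rparr> = app_iso ?h ?P"
    by (simp add: app_iso_def path_arcs_def) (simp add: path_graph_def)
  ultimately show "digraph_iso ?P \<lparr>verts = set p, arcs = path_arcs p, tail = fst, head = snd\<rparr>"
    unfolding digraph_iso_def by blast
qed

lemma path_partitioned_lists:
  assumes "path_partitioned L E U"
  shows "\<exists>Q. U = \<Union>(set ` Q) \<and> (\<forall>p\<in>Q. distinct p \<and> successively E p \<and> length p \<in> L) \<and>
    (\<forall>p\<in>Q. \<forall>q\<in>Q. p \<noteq> q \<longrightarrow> set p \<inter> set q = {})"
  using assms
proof induction
  case empty
  show ?case by (rule exI[of _ "{}"]) simp
next
  case (path U p)
  then obtain Q where Q: "U = \<Union>(set ` Q)"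
    "\<forall>p\<in>Q. distinct p \<and> successively E p \<and> length p \<in> L"
    "\<forall>p\<in>Q. \<forall>q\<in>Q. p \<noteq> q \<longrightarrow> set p \<inter> set q = {}" by blast
  have "set p \<inter> set q = {}" if "q \<in> Q" for q using path.hyps(3) Q(1) that by blast
  then show ?case using Q path.hyps by (intro exI[of _ "insert p Q"]) (simp, blast)
qed

text \<open>The factor keeps all vertices and only the arcs of the chosen paths. Each path is
  strongly connected and closed under arcs, so the paths are the components;
  \<open>0 \<notin> L\<close> excludes the empty list, which is no component.\<close>

lemma has_factor_if_path_partitioned:
  assumes G: "pair_graph G"
    and part: "path_partitioned L (\<lambda>u v. (u, v) \<in> parcs G) (pverts G)" and "0 \<notin> L"
  shows "has_factor (path_graph ` L) G"
proof -
  interpret G: pair_graph G by fact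
  obtain Q where verts: "pverts G = \<Union>(set ` Q)"
    and paths: "\<forall>p\<in>Q. distinct p \<and> successively (\<lambda>u v. (u, v) \<in> parcs G) p \<and> length p \<in> L"
    and disjoint: "\<forall>p\<in>Q. \<forall>q\<in>Q. p \<noteq> q \<longrightarrow> set p \<inter> set q = {}"
    using path_partitioned_lists[OF part] by (elim exE conjE)
  have Q: "distinct p" "successively (\<lambda>u v. (u, v) \<in> parcs G) p" "length p \<in> L" if "p \<in> Q" for p
    using paths that by simp_all
  have disj: "set p \<inter> set q = {}" if "p \<in> Q" "q \<in> Q" "p \<noteq> q" for p q
    using disjoint that by simp
  define F where "F = \<lparr>pverts = pverts G, parcs = \<Union>(path_arcs ` Q)\<rparr>"
  have F_simps: "pverts F = pverts G" "parcs F = \<Union>(path_arcs ` Q)" by (simp_all add: F_def)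
  have sub: "parcs F \<subseteq> parcs G"
  proof
    fix e assume "e \<in> parcs F"
    then obtain p u v where p: "p \<in> Q" "(u, v) \<in> path_arcs p" "e = (u, v)"
      by (cases e) (auto simp: F_simps)
    then obtain i where "Suc i < length p"
        "u = p ! i \<and> v = p ! Suc i \<or> u = p ! Suc i \<and> v = p ! i"
      by (auto simp: in_path_arcs_iff)
    moreover from this have "(p ! i, p ! Suc i) \<in> parcs G"
      using Q(2)[OF p(1)] by (auto simp: successively_conv_nth)
    ultimately show "e \<in> parcs G"
      using p(3) arcs_ends_symmetric[OF G.pair_sym_arcs] by auto
  qed
  have sym: "(v, u) \<in> parcs F" if "(u, v) \<in> parcs F" for u v
    using that by (auto simp: F_simps in_path_arcs_iff)
  have pgF: "pair_graph F"
  proof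
    show "finite (pverts F)" using G.pair_finite_verts by (simp add: F_simps)
    show "finite (parcs F)" using sub G.pair_finite_arcs finite_subset by blast
    show "symmetric (with_proj F)" using sym by (auto simp: symmetric_def intro: symI)
    fix e assume "e \<in> parcs F"
    then have "e \<in> parcs G" using sub by blast
    then show "fst e \<in> pverts F" "snd e \<in> pverts F" "fst e \<noteq> snd e"
      using G.arc_fst_in_verts G.arc_snd_in_verts G.pair_no_loops by (auto simp: F_simps)
  qed
  interpret F: pair_graph F by (rule pgF)
  have "spanning (with_proj F) (with_proj G)"
    using sub F.wf_digraph G.wf_digraph
    by (auto simp: spanning_def subgraph_def compatible_def F_simps)
  moreover have "\<exists>P\<in>path_graph ` L. digraph_iso C (with_proj P)" if C: "C \<in> F.sccs" for C
  proof -
    have path_scc: "set p \<in> F.sccs_verts" if p: "p \<in> Q" for p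
    proof (rule sccs_verts_closedI)
      show "wf_digraph (with_proj F)" by (rule F.wf_digraph)
      show "set p \<noteq> {}" using Q(3)[OF p] \<open>0 \<notin> L\<close> by auto
      show "v \<in> set p" if "u \<in> set p" "u \<rightarrow>\<^bsub>with_proj F\<^esub> v" for u v
      proof -
        obtain q where q: "q \<in> Q" "(u, v) \<in> path_arcs q" using \<open>u \<rightarrow>\<^bsub>with_proj F\<^esub> v\<close> by (auto simp: F_simps)
        then have "u \<in> set q" "v \<in> set q" using path_arcs_in_set[of u v q] by simp_all
        then show ?thesis using disj[OF p q(1)] \<open>u \<in> set p\<close> by auto
      qed
      have from_start: "p ! 0 \<rightarrow>\<^sup>*\<^bsub>with_proj F\<^esub> p ! i" if "i < length p" for i
        using that
      proof (induction i)
        case 0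
        then have "p ! 0 \<in> pverts F" using p nth_mem by (auto simp: F_simps verts)
        then show ?case by auto
      next
        case (Suc i)
        then have "(p ! i, p ! Suc i) \<in> parcs F" using p by (auto simp: F_simps in_path_arcs_iff)
        then have "p ! i \<rightarrow>\<^bsub>with_proj F\<^esub> p ! Suc i" by simp
        then show ?case using Suc F.reachable_adj_trans by simp
      qed
      show "u \<rightarrow>\<^sup>*\<^bsub>with_proj F\<^esub> v" if uv: "u \<in> set p" "v \<in> set p" for u v
      proof -
        obtain i j where "i < length p" "u = p ! i" "j < length p" "v = p ! j"
          using uv by (auto simp: in_set_conv_nth)
        then show ?thesis
          using from_start[of i, THEN symmetric_reachable[OF F.pair_sym_arcs]] from_start[of j]
          by (auto intro: F.reachable_trans)
      qed
    qed
    have vC: "verts C \<in> F.sccs_verts" using C F.sccs_verts_conv by auto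
    then obtain u where u: "u \<in> verts C" by (auto simp: F.in_sccs_verts_conv_reachable)
    then have "u \<rightarrow>\<^sup>*\<^bsub>with_proj F\<^esub> u" using vC by (auto simp: F.in_sccs_verts_conv_reachable)
    then have "u \<in> pverts F" by (auto elim: reachable_in_vertsE)
    then obtain p where p: "p \<in> Q" "u \<in> set p" by (auto simp: F_simps verts)
    then have vC_eq: "verts C = set p" using F.sccs_verts_disjoint[OF vC path_scc] u by blast
    have "C = with_proj F \<restriction> set p"
      using F.induce_eq_iff_induced[OF F.in_sccs_imp_induced[OF C]] vC_eq by simp
    also have "\<dots> = \<lparr>verts = set p, arcs = path_arcs p, tail = fst, head = snd\<rparr>"
    proof -
      \<comment> \<open>Components are induced subgraphs, so arcs of other paths must be excluded;
        they cannot lie inside \<open>set p\<close> because the paths are disjoint.\<close>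
      have "{e \<in> parcs F. fst e \<in> set p \<and> snd e \<in> set p} = path_arcs p"
      proof (intro equalityI subsetI)
        fix e assume "e \<in> {e \<in> parcs F. fst e \<in> set p \<and> snd e \<in> set p}"
        then obtain q where q: "q \<in> Q" "e \<in> path_arcs q" "fst e \<in> set p" by (auto simp: F_simps)
        then have "fst e \<in> set q" using path_arcs_in_set[of "fst e" "snd e" q] by simp
        then have "q = p" using disj[OF p(1) q(1)] q(3) by auto
        then show "e \<in> path_arcs p" using q by simp
      next
        fix e assume "e \<in> path_arcs p"
        then show "e \<in> {e \<in> parcs F. fst e \<in> set p \<and> snd e \<in> set p}"
          using p path_arcs_in_set[of "fst e" "snd e" p] by (auto simp: F_simps)
      qed
      then show ?thesis by (simp add: induce_subgraph_def)
    qed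
    finally show ?thesis using path_graph_iso[OF Q(1)[OF p(1)]] Q(3)[OF p(1)] by auto
  qed
  ultimately have "is_factor (path_graph ` L) F G" using pgF unfolding is_factor_def by blast
  then show ?thesis unfolding has_factor_def by blast
qed

section \<open>Transfer of the component condition\<close>

text \<open>A closed part is a component as soon as it is strongly connected. This is trivial for
  one vertex, and for three vertices \<open>triangle\<close> provides a walk from any start through
  the whole part.\<close>

lemma card_critical_parts_le_num_components:
  assumes G: "pair_graph G" and i: "i = 1 \<or> i = 3"
  shows "card (symmetric_relation.critical_parts (\<lambda>u v. (u, v) \<in> parcs G) (pverts G - X) i)
    \<le> num_components i (delete_verts G X)"
proof -
  interpret G: pair_graph G by fact
  let ?E = "\<lambda>u v. (u, v) \<in> parcs G" and ?H = "delete_verts G X"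
  interpret E: symmetric_relation ?E
    using arcs_ends_symmetric[OF G.pair_sym_arcs] by unfold_locales simp
  have wfH: "wf_digraph ?H" unfolding delete_verts_def by (rule G.wellformed_induce_subgraph)
  interpret H: wf_digraph ?H by (rule wfH)
  have verts_H: "verts ?H = pverts G - X" by (simp add: delete_verts_def)
  have arcs_H: "u \<rightarrow>\<^bsub>?H\<^esub> v \<longleftrightarrow> ?E u v \<and> u \<in> pverts G - X \<and> v \<in> pverts G - X" for u v
    by (force simp: delete_verts_def arcs_ends_conv)
  have finH: "fin_digraph ?H"
  proof
    show "finite (verts ?H)" using G.pair_finite_verts by (simp add: verts_H)
    show "finite (arcs ?H)" using G.pair_finite_arcs by (simp add: delete_verts_def)
  qed
  have "C \<in> pre_digraph.sccs_verts ?H" if "C \<in> E.critical_parts (pverts G - X) i" for C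
  proof (rule sccs_verts_closedI[OF wfH])
    have C: "factor_critical ?E C" "C \<subseteq> pverts G - X" "card C = i"
      and cl: "\<And>u v. u \<in> C \<Longrightarrow> v \<in> pverts G - X - C \<Longrightarrow> \<not> ?E u v"
      using that by (auto simp: E.critical_parts_def closed_in_def)
    show "C \<noteq> {}" using C(1) by (simp add: factor_critical_def)
    show "v \<in> C" if "u \<in> C" "u \<rightarrow>\<^bsub>?H\<^esub> v" for u v using cl[of u v] that arcs_H by auto
    show "u \<rightarrow>\<^sup>*\<^bsub>?H\<^esub> v" if "u \<in> C" "v \<in> C" for u v
    proof (cases "i = 1")
      case True
      then have "u = v" using C(3) that by (auto simp: card_1_singleton_iff)
      then show ?thesis using that C(2) verts_H by auto
    next
      case False
      then have "card C = 3" using i C(3) by simp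
      then obtain y z where yz: "C = {u, y, z}" "?E u y" "?E y z" using E.triangle[OF C(1) _ \<open>u \<in> C\<close>] by blast
      then have "u \<rightarrow>\<^bsub>?H\<^esub> y" "y \<rightarrow>\<^bsub>?H\<^esub> z" using C(2) arcs_H by auto
      then have "u \<rightarrow>\<^sup>*\<^bsub>?H\<^esub> u" "u \<rightarrow>\<^sup>*\<^bsub>?H\<^esub> y" "u \<rightarrow>\<^sup>*\<^bsub>?H\<^esub> z"
        using that C(2) verts_H H.reachable_adjI H.reachable_adj_trans by blast+
      then show ?thesis using yz(1) \<open>v \<in> C\<close> by auto
    qed
  qed
  then show ?thesis
    by (intro card_sccs_verts_le_num_components[OF finH]) (auto simp: E.critical_parts_def)
qed

theorem theorem1:
  fixes G :: "'a pair_pre_digraph"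
  assumes "pair_graph G"
    and "\<And>X. X \<subseteq> pverts G \<Longrightarrow>
      real (num_components 1 (delete_verts G X))
        + 2 / 3 * real (num_components 3 (delete_verts G X))
      \<le> 4 / 3 * real (card X) + 1 / 3"
  shows "has_factor {path_graph 2, path_graph 5} G"
proof -
  interpret G: pair_graph G by fact
  interpret E: symmetric_relation "\<lambda>u v. (u, v) \<in> parcs G"
    using arcs_ends_symmetric[OF G.pair_sym_arcs] by unfold_locales simp
  have "path_partitioned {2, 5} (\<lambda>u v. (u, v) \<in> parcs G) (pverts G)"
  proof (rule E.path_partitioned_if_deficiency_bound[OF G.pair_finite_verts])
    fix X assume "X \<subseteq> pverts G"
    \<comment> \<open>Multiplication by 3 gives the weights 3 and 2, the capacity 4 per vertex and
      the slack 1.\<close>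
    from assms(2)[OF this]
    have "3 * num_components 1 (delete_verts G X) + 2 * num_components 3 (delete_verts G X)
        \<le> 4 * card X + 1" by linarith
    moreover have "card (E.critical_parts (pverts G - X) 1) \<le> num_components 1 (delete_verts G X)"
      "card (E.critical_parts (pverts G - X) 3) \<le> num_components 3 (delete_verts G X)"
      by (intro card_critical_parts_le_num_components[OF assms(1)]; simp)+
    ultimately show "3 * card (E.critical_parts (pverts G - X) 1)
        + 2 * card (E.critical_parts (pverts G - X) 3) \<le> 4 * card X + 1" by linarith
  qed
  then have "has_factor (path_graph ` {2, 5}) G"
    by (rule has_factor_if_path_partitioned[OF assms(1)]) simp
  then show ?thesis by simp
qed

end
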